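(* Let $G=(V,E)$ be a finite graph and let $w:V\to\mathbb{R}_{\geq 0}$. Then, for all $k\geq 0$ and all $1\leq i\leq f_k(I(G))$, \[ \lambda_i\big(L_k^w(I(G))\big)\;\geq\;\Big(\sum_{v\in V} w(v)\Big)-s^{k+1}_i\big(L^w(G)\big), \] where $s^{k+1}_i(L^w(G))$ denotes the $i$-th largest element of the multiset of all sums of $k+1$ eigenvalues of $L^w(G)$.
   Context: The vertex-weighted Laplacian $L^w(G)\in\mathbb{R}^{V\times V}$ is defined by $L^w(G)_{u,u}=\sum_{u'\in N_G(u)}w(u')$, $L^w(G)_{u,v}=-w(v)$ if $\{u,v\}\in E$, and $0$ otherwise ($N_G(u)$ is the set of neighbours of $u$); its eigenvalues are real. For a square matrix $M$ with real eigenvalues, $\lambda_i(M)$ denotes its $i$-th smallest eigenvalue. For an $n\times n$ matrix $M$ with eigenvalues $\mu_1,\dots,\mu_n$ (with multiplicity), $\mathcal{S}_k(M)$ is the multiset $\{\sum_{j\in J}\mu_j : J\subseteq[n],|J|=k\}$. The independence complex $I(G)$ is the simplicial complex on $V$ whose simplices are the independent sets of $G$. For a simplicial complex $X$ on a totally ordered vertex set, $X(k)$ is the set of $k$-dimensional faces (faces of size $k+1$), $f_k(X)=|X(k)|$, and $N_X(\sigma)=\{v\notin\sigma:\sigma\cup\{v\}\in X\}$. For $w$ a non-negative vertex weight, the weighted $k$-dimensional Laplacian $L_k^w(X)$ is the $f_k(X)\times f_k(X)$ matrix indexed by $X(k)$ with entries: $L_k^w(X)_{\sigma,\sigma}=\sum_{u\in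 N_X(\sigma)}w(u)+\sum_{v\in\sigma}w(v)$; if $|\sigma\cap\tau|=k$, $\tau\setminus\sigma=\{v\}$ and $\sigma\cup\tau\notin X$, then $L_k^w(X)_{\sigma,\tau}=(-1)^{\epsilon(\sigma,\tau)}w(v)$, where, writing $\sigma\setminus\tau=\{i\}$, $\tau\setminus\sigma=\{j\}$, $\epsilon(\sigma,\tau)$ is the number of elements of $\sigma\cap\tau$ lying between $i$ and $j$; all other entries are $0$. (For positive $w$ this is the operator $d_k^*d_k+d_{k-1}d_{k-1}^*$ on real cochains, with adjoints taken with respect to the inner product in which the basis cochains $e_\sigma$ are orthogonal with $\langle e_\sigma,e_\sigma\rangle=\prod_{v\in\sigma}w(v)$.) The eigenvalues of $L_k^w(X)$ are real. *)

theory Defs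
  imports "Jordan_Normal_Form.Char_Poly" "HOL-Library.Ramsey"
begin

text \<open>
  A matrix indexed by a finite set \<open>I\<close> is a function \<open>A :: 'i \<Rightarrow> 'i \<Rightarrow> real\<close>, turned into a
  matrix by listing \<open>I\<close> in some order. The choice is harmless here: see
  \<open>char_poly_mat_of_list_cong\<close> below.
\<close>

definition mat_of_list :: "'i list \<Rightarrow> ('i \<Rightarrow> 'i \<Rightarrow> real) \<Rightarrow> real mat" where
  "mat_of_list xs A = mat (length xs) (length xs) (\<lambda>(p, q). A (xs ! p) (xs ! q))"

definition mat_on :: "'i set \<Rightarrow> ('i \<Rightarrow> 'i \<Rightarrow> real) \<Rightarrow> real mat" where
  "mat_on I A = mat_of_list (SOME xs. distinct xs \<and> set xs = I) A"

lemma char_poly_mat_of_list_cong: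
  assumes "distinct xs" "distinct ys" "set xs = set ys"
  shows "char_poly (mat_of_list xs A) = char_poly (mat_of_list ys A)"
proof -
  define n where "n = length ys"
  have lx: "length xs = n"
    using assms distinct_card n_def by metis
  have "\<forall>i. \<exists>p. i < n \<longrightarrow> p < n \<and> ys ! p = xs ! i"
    using assms(3) lx n_def by (metis in_set_conv_nth)
  then obtain f where f: "\<And>i. i < n \<Longrightarrow> f i < n" "\<And>i. i < n \<Longrightarrow> ys ! f i = xs ! i"
    by metis
  have fi: "f i = f j \<longleftrightarrow> i = j" if "i < n" "j < n" for i j
    using f that assms(1) lx by (metis nth_eq_iff_index_eq)
  define P where "P = mat n n (\<lambda>(i, j). if j = f i then 1 else (0::real))"
  define Q where "Q = mat n n (\<lambda>(i, j). if i = f j then 1 else (0::real))"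
  have PQ: "P * Q = 1\<^sub>m n"
    by (rule eq_matI)
       (auto simp: P_def Q_def scalar_prod_def f fi if_distrib[of "\<lambda>x. x * _"] sum.delta cong: if_cong)
  have QP: "Q * P = 1\<^sub>m n"
    by (rule mat_mult_left_right_inverse[OF _ _ PQ]) (auto simp: P_def Q_def)
  define B where "B = mat_of_list ys A"
  have B: "B \<in> carrier_mat n n"
    by (simp add: B_def mat_of_list_def n_def)
  have PB: "P * B = mat n n (\<lambda>(i, j). B $$ (f i, j))"
    using B by (intro eq_matI)
       (auto simp: P_def scalar_prod_def f if_distrib[of "\<lambda>x. x * _"] sum.delta cong: if_cong)
  have "P * B * Q = mat n n (\<lambda>(i, j). B $$ (f i, f j))"
    unfolding PB by (rule eq_matI)
       (auto simp: Q_def scalar_prod_def f if_distrib[of "\<lambda>x. _ * x"] sum.delta cong: if_cong)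
  also have "\<dots> = mat_of_list xs A"
    by (rule eq_matI) (auto simp: mat_of_list_def B_def f lx n_def[symmetric])
  finally have "similar_mat_wit (mat_of_list xs A) B P Q"
    using PQ QP B by (intro similar_mat_witI[of _ _ n])
       (auto simp: P_def Q_def mat_of_list_def lx)
  then show ?thesis
    unfolding B_def by (intro char_poly_similar) (auto simp: similar_mat_def)
qed


text \<open>
  Eigenvalues with algebraic multiplicity. The definitions below are meant for square matrices
  all of whose eigenvalues are real, so that \<open>eigs M\<close> has \<open>dim_row M\<close> elements.
\<close>

definition eigs :: "real mat \<Rightarrow> real multiset" where
  "eigs M = proots (char_poly M)"

definition ith_smallest :: "real multiset \<Rightarrow> nat \<Rightarrow> real" where
  "ith_smallest A i = sorted_list_of_multiset A ! (i - 1)"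

definition ith_largest :: "real multiset \<Rightarrow> nat \<Rightarrow> real" where
  "ith_largest A i = rev (sorted_list_of_multiset A) ! (i - 1)"

definition eig_sums :: "nat \<Rightarrow> real mat \<Rightarrow> real multiset" where
  "eig_sums k M =
     {# \<Sum>j\<in>J. sorted_list_of_multiset (eigs M) ! j . J \<in># mset_set (nsets {..<dim_row M} k) #}"


definition finite_graph :: "'a set \<Rightarrow> 'a set set \<Rightarrow> bool" where
  "finite_graph V E \<longleftrightarrow> finite V \<and> E \<subseteq> nsets V 2"

definition nbrs :: "'a set set \<Rightarrow> 'a \<Rightarrow> 'a set" where
  "nbrs E u = {v. {u, v} \<in> E}"

text \<open>For \<open>u \<noteq> v\<close> the \<open>(u, v)\<close> entry carries the weight of the column vertex \<open>v\<close>.\<close>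

definition graph_laplacian :: "'a set \<Rightarrow> 'a set set \<Rightarrow> ('a \<Rightarrow> real) \<Rightarrow> real mat" where
  "graph_laplacian V E w = mat_on V (\<lambda>u v.
     if u = v then \<Sum>u'\<in>nbrs E u. w u'
     else if {u, v} \<in> E then - w v
     else 0)"


text \<open>Simplicial complexes are given as sets of simplices, including the empty one.\<close>

definition independence_complex :: "'a set \<Rightarrow> 'a set set \<Rightarrow> 'a set set" where
  "independence_complex V E = {\<sigma>. \<sigma> \<subseteq> V \<and> indep \<sigma> E}"

definition faces :: "'a set set \<Rightarrow> nat \<Rightarrow> 'a set set" where
  "faces X k = {\<sigma> \<in> X. card \<sigma> = k + 1}"

definition face_nbrs :: "'a set set \<Rightarrow> 'a set \<Rightarrow> 'a set" where
  "face_nbrs X \<sigma> = {v. v \<notin> \<sigma> \<and> insert v \<sigma> \<in> X}"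

definition eps :: "'a::linorder set \<Rightarrow> 'a set \<Rightarrow> nat" where
  "eps \<sigma> \<tau> = (let i = the_elem (\<sigma> - \<tau>); j = the_elem (\<tau> - \<sigma>)
             in card {x \<in> \<sigma> \<inter> \<tau>. min i j < x \<and> x < max i j})"

definition complex_laplacian :: "'a::linorder set set \<Rightarrow> ('a \<Rightarrow> real) \<Rightarrow> nat \<Rightarrow> real mat" where
  "complex_laplacian X w k = mat_on (faces X k) (\<lambda>\<sigma> \<tau>.
     if \<sigma> = \<tau> then (\<Sum>u\<in>face_nbrs X \<sigma>. w u) + (\<Sum>v\<in>\<sigma>. w v)
     else if card (\<sigma> \<inter> \<tau>) = k \<and> \<sigma> \<union> \<tau> \<notin> X then (- 1) ^ eps \<sigma> \<tau> * w (the_elem (\<tau> - \<sigma>))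
     else 0)"

end

theory Submission
  imports Defs "Jordan_Normal_Form.Schur_Decomposition" "HOL-Combinatorics.Multiset_Permutations"
begin

text \<open>
  Conjugating both Laplacians by square roots of the weights makes them symmetric; zero weights are
  handled by a limit of characteristic polynomials. Write \<open>S\<close> for the symmetrized vertex-weighted
  Laplacian and \<open>M\<close> for its additive compound of order \<open>k + 1\<close>, which acts on functions on the
  \<open>(k + 1)\<close>-subsets of \<open>V\<close>. The symmetrized complex Laplacian is \<open>(\<Sum>v\<in>V. w v)\<close> times the
  identity, minus the principal submatrix of \<open>M\<close> on the independent sets, plus a non-negative
  diagonal matrix, so the bound is an interlacing argument: some non-zero combination \<open>f\<close> of the
  first \<open>i\<close> eigenvectors of the complex Laplacian is orthogonal to the eigenvectors of \<open>M\<close> belonging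
  to the at most \<open>i - 1\<close> sums that exceed the \<open>i\<close>-th largest one.

  The compound is never formed as a matrix. A function \<open>f\<close> on \<open>(k + 1)\<close>-subsets becomes an
  alternating tensor on lists of length \<open>k + 1\<close>, which is expanded in products of eigenvectors of
  \<open>S\<close>. The coefficients are again alternating, so only products of \<open>k + 1\<close> different eigenvectors
  matter, up to order.
\<close>

section \<open>Real symmetric matrices\<close>

text \<open>Complete \<open>v\<close> to a basis, run Gram-Schmidt and normalize. Gram-Schmidt keeps
  the first vector, so the first column of \<open>W\<close> is still a multiple of
  \<open>v\<close>.\<close>

lemma orthogonal_mat_completion:
  fixes v :: "real vec"
  assumes v: "v \<in> carrier_vec n" "v \<noteq> 0\<^sub>v n"
  obtains W c where "W \<in> carrier_mat n n" "transpose_mat W * W = 1\<^sub>m n" "col W 0 = c \<cdot>\<^sub>v v"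
proof -
  interpret cof_vec_space n "TYPE(real)" .
  define b where "b = basis_completion v"
  define ws where "ws = gram_schmidt n b"
  from basis_completion[OF v, folded b_def]
  have dist_b: "distinct b" and indep: "\<not> lin_dep (set b)" and b: "set b \<subseteq> carrier_vec n"
    and hdb: "hd b = v" and len_b: "length b = n"
    by auto
  have n: "n \<noteq> 0" using v by (metis carrier_vecD eq_vecI index_zero_vec(2) less_nat_zero_code)
  from hdb len_b n obtain vs where bv: "b = v # vs" by (cases b) auto
  from gram_schmidt_result[OF b dist_b indep refl, folded ws_def]
  have ws: "set ws \<subseteq> carrier_vec n" "corthogonal ws" "length ws = n" by (auto simp: len_b)
  have hdws: "ws ! 0 = v"
    using gram_schmidt_hd[OF v(1), of vs, folded bv ws_def] ws(3) n
    by (metis hd_conv_nth list.size(3))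
  define us where "us = map (\<lambda>u. (1 / sqrt (u \<bullet> u)) \<cdot>\<^sub>v u) ws"
  define W where "W = mat_of_cols n us"
  have W: "W \<in> carrier_mat n n" using ws(3) mat_of_cols_carrier(1)[of n us] by (simp add: W_def us_def)
  have wsc: "ws ! i \<in> carrier_vec n" if "i < n" for i using ws that by auto
  have colW: "col W i = (1 / sqrt (ws ! i \<bullet> ws ! i)) \<cdot>\<^sub>v ws ! i" if "i < n" for i
    using that ws wsc unfolding W_def us_def by simp
  \<comment> \<open>Conjugation is trivial over the reals, so \<open>corthogonal\<close> is ordinary
    orthogonality.\<close>
  have conj: "conjugate x = x" for x :: "real vec" by (rule eq_vecI) simp_all
  have orth: "ws ! i \<bullet> ws ! j = 0 \<longleftrightarrow> i \<noteq> j" if "i < n" "j < n" for i j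
    using corthogonalD[OF ws(2)] that ws(3) conj by simp
  have "transpose_mat W * W = 1\<^sub>m n"
  proof (rule eq_matI)
    fix i j assume "i < dim_row (1\<^sub>m n :: real mat)" "j < dim_col (1\<^sub>m n :: real mat)"
    hence ij: "i < n" "j < n" by auto
    have pos: "ws ! i \<bullet> ws ! i > 0"
      using orth[OF ij(1) ij(1)] sum_nonneg[of "{0..<dim_vec (ws ! i)}" "\<lambda>k. ws ! i $ k * ws ! i $ k"]
      unfolding scalar_prod_def by simp
    have "(transpose_mat W * W) $$ (i, j) = col W i \<bullet> col W j" using W ij by simp
    also have "\<dots> = (1 / sqrt (ws ! i \<bullet> ws ! i)) * ((1 / sqrt (ws ! j \<bullet> ws ! j)) * (ws ! i \<bullet> ws ! j))"
      by (simp only: colW ij smult_scalar_prod_distrib[OF wsc[OF ij(1)] smult_carrier_vec[THEN iffD2, OF wsc[OF ij(2)]]]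
          scalar_prod_smult_distrib[OF wsc[OF ij(1)] wsc[OF ij(2)]])
    also have "\<dots> = (1\<^sub>m n :: real mat) $$ (i, j)"
      using orth[OF ij] pos ij by (cases "i = j") auto
    finally show "(transpose_mat W * W) $$ (i, j) = 1\<^sub>m n $$ (i, j)" .
  qed (use W in auto)
  moreover have "col W 0 = (1 / sqrt (v \<bullet> v)) \<cdot>\<^sub>v v" using colW[of 0] n hdws by simp
  ultimately show ?thesis using W that by blast
qed

text \<open>Deflation: an orthogonal \<open>W\<close> whose first column is an eigenvector for the
  root \<open>e\<close> splits off a 1 by 1 block, and the remaining block is symmetric with the
  remaining roots. The order of \<open>es\<close> is arbitrary, so the roots may later be listed in
  increasing order.\<close>

lemma real_symmetric_diagonalization:
  fixes A :: "real mat"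
  assumes "A \<in> carrier_mat n n" "transpose_mat A = A"
    and "char_poly A = (\<Prod>e\<leftarrow>es. [:- e, 1:])"
  shows "\<exists>U \<in> carrier_mat n n. transpose_mat U * U = 1\<^sub>m n \<and>
    transpose_mat U * A * U = mat n n (\<lambda>(i, j). if i = j then es ! i else 0)"
  using assms
proof (induction es arbitrary: n A)
  case Nil
  have "n = 0" using degree_monic_char_poly[OF Nil(1)] Nil(3) by simp
  then show ?case using Nil by (intro bexI[of _ "1\<^sub>m 0"]) auto
next
  case (Cons e es)
  note A = Cons.prems(1)
  define m where "m = n - 1"
  have "degree (char_poly A) = length (e # es)"
    unfolding Cons.prems(3) by (rule degree_linear_factors)
  hence n: "n = Suc m" "length es = m" using degree_monic_char_poly[OF A] by (auto simp: m_def)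
  have "eigenvalue A e" unfolding eigenvalue_root_char_poly[OF A] Cons.prems(3) by simp
  then obtain v where "eigenvector A v e" unfolding eigenvalue_def by auto
  hence v: "v \<in> carrier_vec n" "v \<noteq> 0\<^sub>v n" "A *\<^sub>v v = e \<cdot>\<^sub>v v" using A by (auto simp: eigenvector_def)
  obtain W c where W: "W \<in> carrier_mat n n" and WW: "transpose_mat W * W = 1\<^sub>m n"
    and W0: "col W 0 = c \<cdot>\<^sub>v v"
    using orthogonal_mat_completion[OF v(1,2)] .
  define A' where "A' = transpose_mat W * A * W"
  have A': "A' \<in> carrier_mat n n" using A W by (simp add: A'_def)
  have symA': "transpose_mat A' = A'"
  proof -
    have "transpose_mat A' = transpose_mat W * transpose_mat (transpose_mat W * A)"
      unfolding A'_def using A W by (intro transpose_mult) auto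
    also have "transpose_mat (transpose_mat W * A) = transpose_mat A * W"
      using transpose_mult[of "transpose_mat W" n n A n] A W by simp
    also have "transpose_mat W * (transpose_mat A * W) = A'"
      using assoc_mult_mat[of "transpose_mat W" n n A n W n] A W by (simp add: A'_def Cons.prems(2))
    finally show ?thesis .
  qed
  have A'0: "A' $$ (i, 0) = (if i = 0 then e else 0)" if i: "i < n" for i
  proof -
    have "A' = transpose_mat W * (A * W)" using A W unfolding A'_def by auto
    hence "A' $$ (i, 0) = col W i \<bullet> col (A * W) 0" using i n A W by simp
    also have "col (A * W) 0 = A *\<^sub>v col W 0" using A W n by (intro col_mult2) auto
    also have "\<dots> = e \<cdot>\<^sub>v col W 0" unfolding W0 using v A by (simp add: mult_mat_vec smult_smult_assoc mult.commute)
    also have "col W i \<bullet> (e \<cdot>\<^sub>v col W 0) = e * (col W i \<bullet> col W 0)" using W by simp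
    also have "col W i \<bullet> col W 0 = (transpose_mat W * W) $$ (i, 0)" using W i n by simp
    finally show ?thesis using i n by (simp add: WW)
  qed
  \<comment> \<open>Symmetry clears the first row as well as the first column, which makes
    \<open>A'\<close> block diagonal.\<close>
  have A'0': "A' $$ (0, i) = (if i = 0 then e else 0)" if i: "i < n" for i
    using A'0[OF i] symA' A' i n by (metis carrier_matD index_transpose_mat(1) zero_less_Suc)
  define A3 where "A3 = mat m m (\<lambda>(i, j). A' $$ (Suc i, Suc j))"
  have A3: "A3 \<in> carrier_mat m m" by (simp add: A3_def)
  have e1: "mat 1 1 (\<lambda>_. e) \<in> carrier_mat 1 1" by simp
  have block: "A' = four_block_mat (mat 1 1 (\<lambda>_. e)) (0\<^sub>m 1 m) (0\<^sub>m m 1) A3"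
    using A' n A'0 A'0' by (intro eq_matI) (auto simp: A3_def)
  have symA3: "transpose_mat A3 = A3"
  proof (rule eq_matI)
    fix i j assume "i < dim_row A3" "j < dim_col A3"
    hence "i < m" "j < m" by (auto simp: A3_def)
    thus "transpose_mat A3 $$ (i, j) = A3 $$ (i, j)"
      using symA' A' n unfolding A3_def
      by (simp, metis Suc_less_eq carrier_matD index_transpose_mat(1))
  qed (auto simp: A3_def)
  have WW': "W * transpose_mat W = 1\<^sub>m n"
    using mat_mult_left_right_inverse[OF _ _ WW] W by simp
  have "similar_mat_wit A' A (transpose_mat W) W"
    using W A A' WW WW' by (intro similar_mat_witI[of _ _ n]) (auto simp: A'_def)
  hence "char_poly A' = char_poly A" by (intro char_poly_similar) (auto simp: similar_mat_def)
  moreover have "char_poly A' = char_poly (mat 1 1 (\<lambda>_. e)) * char_poly A3"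
    unfolding block by (rule char_poly_four_block_zeros_col[OF e1 _ A3]) simp
  moreover have "char_poly (mat 1 1 (\<lambda>_. e)) = [:- e, 1:]"
    by (simp add: char_poly_defs det_def sign_def)
  ultimately have "[:- e, 1:] * char_poly A3 = [:- e, 1:] * (\<Prod>e\<leftarrow>es. [:- e, 1:])"
    using Cons.prems(3) by simp
  hence "char_poly A3 = (\<Prod>e\<leftarrow>es. [:- e, 1:])"
    by (subst (asm) mult_left_cancel) auto
  from Cons.IH[OF A3 symA3 this] obtain U3 where U3: "U3 \<in> carrier_mat m m"
    and U3U3: "transpose_mat U3 * U3 = 1\<^sub>m m"
    and U3A3: "transpose_mat U3 * A3 * U3 = mat m m (\<lambda>(i, j). if i = j then es ! i else 0)"
    by auto
  \<comment> \<open>\<open>Z\<close> lets \<open>U3\<close> act on the last \<open>m\<close>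
    coordinates and fixes the first; \<open>W * Z\<close> is the required orthogonal matrix.\<close>
  define Z where "Z = four_block_mat (1\<^sub>m 1) (0\<^sub>m 1 m) (0\<^sub>m m 1) U3"
  have Z: "Z \<in> carrier_mat n n" using four_block_carrier_mat[of "1\<^sub>m 1" 1 1 U3 m m] U3 n by (simp add: Z_def)
  have Zt: "transpose_mat Z = four_block_mat (1\<^sub>m 1) (0\<^sub>m 1 m) (0\<^sub>m m 1) (transpose_mat U3)"
    unfolding Z_def using U3 by (subst transpose_four_block_mat) auto
  have ZZ: "transpose_mat Z * Z = 1\<^sub>m n"
    unfolding Zt unfolding Z_def using U3 n
    by (subst mult_four_block_mat[of _ 1 1 _ m _ m _ _ 1 _ m])
       (auto simp: U3U3 intro!: eq_matI)
  have ZA: "transpose_mat Z * A' = four_block_mat (mat 1 1 (\<lambda>_. e)) (0\<^sub>m 1 m) (0\<^sub>m m 1) (transpose_mat U3 * A3)"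
    unfolding Zt block using U3 A3
    by (subst mult_four_block_mat[of _ 1 1 _ m _ m _ _ 1 _ m]) auto
  have ZAZ: "transpose_mat Z * A' * Z = mat n n (\<lambda>(i, j). if i = j then (e # es) ! i else 0)"
    unfolding ZA unfolding Z_def using U3 A3 n
    by (subst mult_four_block_mat[of _ 1 1 _ m _ m _ _ 1 _ m])
       (auto simp: U3A3 nth_Cons' intro!: eq_matI)
  have tWZ: "transpose_mat (W * Z) = transpose_mat Z * transpose_mat W"
    using W Z by (rule transpose_mult)
  have "transpose_mat (W * Z) * (W * Z) = transpose_mat Z * (transpose_mat W * W) * Z"
    unfolding tWZ using W Z by (auto simp: assoc_mult_mat[of _ n n _ n _ n])
  also have "\<dots> = 1\<^sub>m n" using Z by (simp add: WW ZZ)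
  finally have 1: "transpose_mat (W * Z) * (W * Z) = 1\<^sub>m n" .
  have "transpose_mat (W * Z) * A * (W * Z) = transpose_mat Z * A' * Z"
    unfolding tWZ A'_def using W Z A by (auto simp: assoc_mult_mat[of _ n n _ n _ n])
  with 1 ZAZ show ?case using W Z by (intro bexI[of _ "W * Z"]) auto
qed

lemma proots_prod_list_linear: "proots (\<Prod>e\<leftarrow>es. [:- e, 1:]) = mset (es :: real list)"
proof (induction es)
  case (Cons e es)
  have "(\<Prod>e\<leftarrow>es. [:- e, 1:]) \<noteq> (0 :: real poly)" by (auto simp: prod_list_zero_iff)
  then show ?case using Cons
    by (simp only: list.map prod_list.Cons, subst proots_mult) auto
qed simp

text \<open>For an eigenvector \<open>v\<close> of the complexification, \<open>v\<^sup>* A v\<close> is its own conjugate.\<close>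

lemma char_poly_real_symmetric_splits:
  fixes A :: "real mat"
  assumes A: "A \<in> carrier_mat n n" and sym: "transpose_mat A = A"
  shows "\<exists>es. char_poly A = (\<Prod>e\<leftarrow>es. [:- e, 1:])"
proof -
  let ?C = "map_mat complex_of_real A"
  have C: "?C \<in> carrier_mat n n" using A by simp
  obtain as where as: "char_poly ?C = (\<Prod>a\<leftarrow>as. [:- a, 1:])"
    using char_poly_factorized[OF C] by blast
  have symij: "A $$ (i, j) = A $$ (j, i)" if "i < n" "j < n" for i j
    using sym A that by (metis carrier_matD index_transpose_mat(1))
  have real: "complex_of_real (Re a) = a" if "a \<in> set as" for a
  proof -
    have "poly (char_poly ?C) a = 0" unfolding as using that
      by (auto simp: poly_prod_list prod_list_zero_iff)
    then obtain v where "eigenvector ?C v a"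
      unfolding eigenvalue_root_char_poly[OF C, symmetric] eigenvalue_def by auto
    hence v: "v \<in> carrier_vec n" "v \<noteq> 0\<^sub>v n" "?C *\<^sub>v v = a \<cdot>\<^sub>v v"
      using A by (auto simp: eigenvector_def)
    have ev: "(\<Sum>j<n. complex_of_real (A $$ (i, j)) * v $ j) = a * v $ i" if "i < n" for i
    proof -
      have "(?C *\<^sub>v v) $ i = (\<Sum>j<n. complex_of_real (A $$ (i, j)) * v $ j)"
        using A v(1) that by (simp add: scalar_prod_def lessThan_atLeast0)
      thus ?thesis using v that by simp
    qed
    define q where "q = (\<Sum>i<n. \<Sum>j<n. cnj (v $ i) * (complex_of_real (A $$ (i, j)) * v $ j))"
    define N where "N = (\<Sum>i<n. (cmod (v $ i))\<^sup>2)"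
    have "q = (\<Sum>i<n. cnj (v $ i) * (a * v $ i))"
      unfolding q_def by (intro sum.cong) (simp_all add: ev sum_distrib_left[symmetric])
    also have "\<dots> = a * of_real N"
      unfolding N_def of_real_sum sum_distrib_left
      by (intro sum.cong) (simp_all add: complex_norm_square[unfolded of_real_power] mult_ac)
    finally have qN: "q = a * of_real N" .
    have "cnj q = (\<Sum>i<n. \<Sum>j<n. v $ i * (complex_of_real (A $$ (i, j)) * cnj (v $ j)))"
      by (simp add: q_def)
    also have "\<dots> = q"
      unfolding q_def by (subst sum.swap) (auto intro!: sum.cong simp: symij mult_ac)
    finally have "cnj a * of_real N = a * of_real N" using qN by (metis complex_cnj_complex_of_real complex_cnj_mult)
    moreover have "N \<noteq> 0"
    proof
      assume "N = 0"
      hence "\<forall>i<n. v $ i = 0" unfolding N_def by (subst (asm) sum_nonneg_eq_0_iff) auto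
      thus False using v by (auto intro!: eq_vecI)
    qed
    ultimately have "cnj a = a" by simp
    thus ?thesis by (simp add: complex_eq_iff)
  qed
  interpret of_real_cpoly: map_poly_inj_comm_ring_hom complex_of_real ..
  \<comment> \<open>Since all roots are real, the complex factorization is the image of a real one,
    and the embedding of real polynomials is injective.\<close>
  have "map_poly complex_of_real (char_poly A) = (\<Prod>a\<leftarrow>as. [:- a, 1:])"
    using of_real_hom.char_poly_hom[OF A] as by metis
  also have "\<dots> = (\<Prod>a\<leftarrow>as. map_poly complex_of_real [:- Re a, 1:])"
    using real by (intro arg_cong[of _ _ prod_list] map_cong) auto
  also have "\<dots> = map_poly complex_of_real (\<Prod>a\<leftarrow>map Re as. [:- a, 1:])"
    unfolding of_real_cpoly.hom_prod_list map_map o_def ..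
  finally have "char_poly A = (\<Prod>a\<leftarrow>map Re as. [:- a, 1:])"
    by (simp only: of_real_cpoly.eq_iff)
  thus ?thesis by blast
qed

text \<open>The spectral theorem in terms of functions on \<open>I\<close>: \<open>v j\<close> is
  column \<open>j\<close> of the diagonalizing matrix \<open>U\<close>, and the two orthogonality
  relations are \<open>U\<^sup>T U = 1\<close> and \<open>U U\<^sup>T = 1\<close>.\<close>

lemma mat_of_list_spectral:
  fixes A :: "'i \<Rightarrow> 'i \<Rightarrow> real"
  assumes xs: "distinct xs" "set xs = I"
    and sym: "\<And>a b. a \<in> I \<Longrightarrow> b \<in> I \<Longrightarrow> A a b = A b a"
  defines "\<mu> \<equiv> sorted_list_of_multiset (eigs (mat_of_list xs A))"
  obtains v :: "nat \<Rightarrow> 'i \<Rightarrow> real" where "length \<mu> = card I"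
    and "\<And>j l. j < card I \<Longrightarrow> l < card I \<Longrightarrow> (\<Sum>a\<in>I. v j a * v l a) = (if j = l then 1 else 0)"
    and "\<And>a b. a \<in> I \<Longrightarrow> b \<in> I \<Longrightarrow> (\<Sum>j<card I. v j a * v j b) = (if a = b then 1 else 0)"
    and "\<And>a b. a \<in> I \<Longrightarrow> b \<in> I \<Longrightarrow> A a b = (\<Sum>j<card I. \<mu> ! j * (v j a * v j b))"
proof -
  define n where "n = length xs"
  have cI: "card I = n" using xs distinct_card n_def by metis
  define M where "M = mat_of_list xs A"
  have M: "M \<in> carrier_mat n n" by (simp add: M_def mat_of_list_def n_def)
  have Mt: "transpose_mat M = M"
    using sym xs by (intro eq_matI) (auto simp: M_def mat_of_list_def)
  obtain es where es: "char_poly M = (\<Prod>e\<leftarrow>es. [:- e, 1:])"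
    using char_poly_real_symmetric_splits[OF M Mt] by blast
  have m\<mu>: "mset \<mu> = mset es" unfolding \<mu>_def M_def[symmetric] eigs_def es
    by (simp add: proots_prod_list_linear)
  hence "mset (map (\<lambda>e. [:- e, 1:]) es) = mset (map (\<lambda>e. [:- e, 1:]) \<mu>)" by simp
  \<comment> \<open>The linear factors are reordered so that column \<open>j\<close> of
    \<open>U\<close> belongs to the \<open>j\<close>-th entry of the sorted list
    \<open>\<mu>\<close>.\<close>
  hence cp: "char_poly M = (\<Prod>e\<leftarrow>\<mu>. [:- e, 1:])"
    unfolding es by (metis prod_mset_prod_list)
  have len: "length \<mu> = n"
    using degree_monic_char_poly[OF M] unfolding cp degree_linear_factors by simp
  obtain U where U: "U \<in> carrier_mat n n" and UU: "transpose_mat U * U = 1\<^sub>m n"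
    and UMU: "transpose_mat U * M * U = mat n n (\<lambda>(i, j). if i = j then \<mu> ! i else 0)"
    using real_symmetric_diagonalization[OF M Mt cp] by auto
  have UU': "U * transpose_mat U = 1\<^sub>m n" using mat_mult_left_right_inverse[OF _ _ UU] U by simp
  define D where "D = mat n n (\<lambda>(i, j). if i = j then \<mu> ! i else 0)"
  have D: "D \<in> carrier_mat n n" by (simp add: D_def)
  have "U * D * transpose_mat U = (U * transpose_mat U) * M * (U * transpose_mat U)"
    unfolding D_def UMU[symmetric] using U M by (auto simp: assoc_mult_mat[of _ n n _ n _ n])
  hence MUD: "M = U * D * transpose_mat U" using M by (simp add: UU')
  define ix where "ix = inv_into {..<n} ((!) xs)"
  have bij: "bij_betw ((!) xs) {..<n} I" using bij_betw_nth[OF xs(1), of "{..<n}" I] xs n_def by simp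
  have ix: "ix a < n" "xs ! ix a = a" if "a \<in> I" for a
    using that bij inv_into_into[of a "(!) xs" "{..<n}"] f_inv_into_f[of a "(!) xs" "{..<n}"]
    unfolding ix_def bij_betw_def by auto
  have ix_nth: "ix (xs ! p) = p" if "p < n" for p
    using that bij unfolding ix_def bij_betw_def by (simp add: inv_into_f_f)
  have ix_inj: "ix a = ix b \<longleftrightarrow> a = b" if "a \<in> I" "b \<in> I" for a b using that ix by metis
  define v where "v = (\<lambda>j a. U $$ (ix a, j))"
  show ?thesis
  proof
    show "length \<mu> = card I" using len cI by simp
    fix j l assume "j < card I" "l < card I"
    hence jl: "j < n" "l < n" using cI by auto
    have "(\<Sum>a\<in>I. v j a * v l a) = (\<Sum>p<n. U $$ (p, j) * U $$ (p, l))"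
      unfolding v_def by (subst sum.reindex_bij_betw[OF bij, symmetric]) (simp add: ix_nth)
    also have "\<dots> = (transpose_mat U * U) $$ (j, l)"
      using U jl by (simp add: scalar_prod_def lessThan_atLeast0)
    finally show "(\<Sum>a\<in>I. v j a * v l a) = (if j = l then 1 else 0)" using jl by (simp add: UU)
  next
    fix a b assume ab: "a \<in> I" "b \<in> I"
    have "(\<Sum>j<card I. v j a * v j b) = (U * transpose_mat U) $$ (ix a, ix b)"
      using U ix[OF ab(1)] ix[OF ab(2)] by (simp add: v_def cI scalar_prod_def lessThan_atLeast0)
    thus "(\<Sum>j<card I. v j a * v j b) = (if a = b then 1 else 0)"
      using ix[OF ab(1)] ix[OF ab(2)] ix_inj[OF ab] by (simp add: UU')
    have UD: "(U * D) $$ (p, j) = U $$ (p, j) * \<mu> ! j" if "p < n" "j < n" for p j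
    proof -
      have "(U * D) $$ (p, j) = (\<Sum>q<n. U $$ (p, q) * (if q = j then \<mu> ! q else 0))"
        using U that by (simp add: D_def scalar_prod_def lessThan_atLeast0)
      also have "\<dots> = U $$ (p, j) * \<mu> ! j" using that by (simp add: if_distrib sum.delta cong: if_cong)
      finally show ?thesis .
    qed
    have "A a b = M $$ (ix a, ix b)"
      using ix[OF ab(1)] ix[OF ab(2)] by (simp add: M_def mat_of_list_def n_def)
    also have "\<dots> = (\<Sum>j<n. (U * D) $$ (ix a, j) * U $$ (ix b, j))"
      unfolding MUD using U D ix[OF ab(1)] ix[OF ab(2)]
      by (simp add: scalar_prod_def lessThan_atLeast0 del: assoc_mult_mat)
    also have "\<dots> = (\<Sum>j<n. \<mu> ! j * (v j a * v j b))"
      using ix[OF ab(1)] by (intro sum.cong) (auto simp: UD v_def)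
    finally show "A a b = (\<Sum>j<card I. \<mu> ! j * (v j a * v j b))" using cI by simp
  qed
qed

section \<open>Characteristic polynomials under limits and diagonal similarity\<close>

text \<open>By the Leibniz formula, the value at a fixed \<open>x\<close> is a polynomial in the
  matrix entries.\<close>

lemma tendsto_poly_char_poly:
  fixes A :: "'b \<Rightarrow> real mat"
  assumes A: "\<And>e. A e \<in> carrier_mat n n" and B: "B \<in> carrier_mat n n"
    and lim: "\<And>i j. i < n \<Longrightarrow> j < n \<Longrightarrow> ((\<lambda>e. A e $$ (i, j)) \<longlongrightarrow> B $$ (i, j)) F"
  shows "((\<lambda>e. poly (char_poly (A e)) x) \<longlongrightarrow> poly (char_poly B) x) F"
proof -
  have *: "poly (char_poly C) x = (\<Sum>p\<in>{p. p permutes {0..<n}}. signof p *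
      (\<Prod>i = 0..<n. (if i = p i then x else 0) - C $$ (i, p i)))" if C: "C \<in> carrier_mat n n" for C :: "real mat"
  proof -
    have "(- char_matrix C x) $$ (i, p i) = (if i = p i then x else 0) - C $$ (i, p i)"
      if "i < n" "p permutes {0..<n}" for i p
      using C that permutes_in_image[OF that(2), of i] by (simp add: char_matrix_def)
    moreover have "- char_matrix C x \<in> carrier_mat n n" using C by (simp add: char_matrix_def)
    ultimately show ?thesis
      unfolding char_poly_matrix[OF C] by (simp add: det_def')
  qed
  show ?thesis
    unfolding *[OF A] *[OF B]
    by (intro tendsto_sum tendsto_mult tendsto_prod tendsto_diff tendsto_const lim)
       (auto dest: permutes_in_image[of _ "{0..<n}"])
qed

text \<open>The second hypothesis is \<open>B = H A H\<^sup>-\<^sup>1\<close> with \<open>H\<close>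
  the diagonal matrix of \<open>h\<close>, multiplied out to avoid division.\<close>

lemma char_poly_mat_of_list_scale:
  fixes A B :: "'i \<Rightarrow> 'i \<Rightarrow> real"
  assumes h: "\<And>a. a \<in> set xs \<Longrightarrow> h a \<noteq> 0"
    and AB: "\<And>a b. a \<in> set xs \<Longrightarrow> b \<in> set xs \<Longrightarrow> B a b * h b = h a * A a b"
  shows "char_poly (mat_of_list xs A) = char_poly (mat_of_list xs B)"
proof -
  define n where "n = length xs"
  define H where "H = (\<lambda>g :: 'i \<Rightarrow> real. mat n n (\<lambda>(i, j). if i = j then g (xs ! i) else 0))"
  have HH: "H g * mat_of_list xs C = mat_of_list xs (\<lambda>a b. g a * C a b)" for g C
    by (rule eq_matI)
       (auto simp: H_def mat_of_list_def n_def scalar_prod_def if_distrib[of "\<lambda>x. x * _"] sum.delta cong: if_cong)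
  have HH': "mat_of_list xs C * H g = mat_of_list xs (\<lambda>a b. C a b * g b)" for g C
    by (rule eq_matI)
       (auto simp: H_def mat_of_list_def n_def scalar_prod_def if_distrib[of "\<lambda>x. _ * x"] sum.delta' cong: if_cong)
  have H1: "H g * H f = 1\<^sub>m n" if "\<And>a. a \<in> set xs \<Longrightarrow> g a * f a = 1" for f g
    using that by (intro eq_matI)
       (auto simp: H_def n_def scalar_prod_def if_distrib[of "\<lambda>x. x * _"] sum.delta cong: if_cong)
  have "H h * mat_of_list xs A * H (\<lambda>a. 1 / h a) = mat_of_list xs B"
    unfolding HH HH' using h AB
    by (intro eq_matI) (auto simp: mat_of_list_def field_simps)
  moreover have "H h * H (\<lambda>a. 1 / h a) = 1\<^sub>m n" "H (\<lambda>a. 1 / h a) * H h = 1\<^sub>m n"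
    using h by (auto intro!: H1)
  ultimately have "similar_mat_wit (mat_of_list xs B) (mat_of_list xs A) (H h) (H (\<lambda>a. 1 / h a))"
    by (intro similar_mat_witI[of _ _ n]) (auto simp: H_def mat_of_list_def n_def)
  thus ?thesis by (intro char_poly_similar[symmetric]) (auto simp: similar_mat_def)
qed

text \<open>Zero weights make the scaling factors vanish; they are reached as a limit of positive ones.\<close>

lemma char_poly_mat_of_list_scale_limit:
  fixes A B :: "real \<Rightarrow> 'i \<Rightarrow> 'i \<Rightarrow> real"
  assumes h: "\<And>e a. e > 0 \<Longrightarrow> a \<in> set xs \<Longrightarrow> h e a \<noteq> 0"
    and AB: "\<And>e a b. e > 0 \<Longrightarrow> a \<in> set xs \<Longrightarrow> b \<in> set xs \<Longrightarrow> B e a b * h e b = h e a * A e a b"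
    and A: "\<And>a b. a \<in> set xs \<Longrightarrow> b \<in> set xs \<Longrightarrow> continuous_on UNIV (\<lambda>e. A e a b)"
    and B: "\<And>a b. a \<in> set xs \<Longrightarrow> b \<in> set xs \<Longrightarrow> continuous_on UNIV (\<lambda>e. B e a b)"
  shows "char_poly (mat_of_list xs (A 0)) = char_poly (mat_of_list xs (B 0))"
proof -
  have lim: "(g \<longlongrightarrow> g 0) (at_right 0)" if "continuous_on UNIV g" for g :: "real \<Rightarrow> real"
    using that by (auto simp: continuous_on_def intro: tendsto_within_subset)
  have "poly (char_poly (mat_of_list xs (A 0))) x = poly (char_poly (mat_of_list xs (B 0))) x" for x
  proof -
    have A': "((\<lambda>e. poly (char_poly (mat_of_list xs (A e))) x) \<longlongrightarrow> poly (char_poly (mat_of_list xs (A 0))) x) (at_right 0)"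
      by (rule tendsto_poly_char_poly[of _ "length xs"]) (auto simp: mat_of_list_def intro!: lim[OF A])
    have B': "((\<lambda>e. poly (char_poly (mat_of_list xs (B e))) x) \<longlongrightarrow> poly (char_poly (mat_of_list xs (B 0))) x) (at_right 0)"
      by (rule tendsto_poly_char_poly[of _ "length xs"]) (auto simp: mat_of_list_def intro!: lim[OF B])
    have ev: "\<forall>\<^sub>F e in at_right 0. poly (char_poly (mat_of_list xs (B e))) x = poly (char_poly (mat_of_list xs (A e))) x"
    proof (rule eventually_at_rightI[of 0 1])
      fix e :: real assume "e \<in> {0<..<1}"
      hence "e > 0" by simp
      from char_poly_mat_of_list_scale[of xs "h e", OF h[OF this] AB[OF this]]
      show "poly (char_poly (mat_of_list xs (B e))) x = poly (char_poly (mat_of_list xs (A e))) x"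
        by simp
    qed simp
    \<comment> \<open>The two families have the same values for every \<open>e > 0\<close>, hence
      the same one-sided limit at 0.\<close>
    show ?thesis
      by (rule tendsto_unique[OF trivial_limit_at_right_real A' Lim_transform_eventually[OF B' ev]])
  qed
  thus ?thesis by (intro poly_eq_poly_eq_iff[THEN iffD1] ext)
qed

section \<open>Alternating tensors\<close>

text \<open>The coordinates of a tensor of order \<open>m\<close> on \<open>V\<close> are indexed by
  these lists; letters may repeat.\<close>

definition words :: "'a set \<Rightarrow> nat \<Rightarrow> 'a list set" where
  "words V m = {t. set t \<subseteq> V \<and> length t = m}"

lemma finite_words: "finite V \<Longrightarrow> finite (words V m)"
  unfolding words_def by (rule finite_lists_length_eq)

lemma sum_words_0 [simp]: "(\<Sum>t\<in>words V 0. h t) = h []"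
proof -
  have "words V 0 = {[]}" by (auto simp: words_def)
  thus ?thesis by simp
qed

lemma sum_words_Suc:
  "(\<Sum>t\<in>words V (Suc m). h t) = (\<Sum>a\<in>V. \<Sum>t\<in>words V m. h (a # t))"
proof -
  have "(\<Sum>a\<in>V. \<Sum>t\<in>words V m. h (a # t)) = (\<Sum>(a, t)\<in>V \<times> words V m. h (a # t))"
    by (rule sum.cartesian_product)
  also have "\<dots> = (\<Sum>t\<in>words V (Suc m). h t)"
    by (rule sum.reindex_bij_witness[of _ "\<lambda>t. (hd t, tl t)" "\<lambda>(a, t). a # t"])
       (auto simp: words_def length_Suc_conv)
  finally show ?thesis ..
qed

text \<open>Adjacent transpositions generate all permutations, so this is full antisymmetry. It is
  required on all lists, so fixing the first letter preserves it.\<close>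

definition alternating :: "('a list \<Rightarrow> real) \<Rightarrow> bool" where
  "alternating f \<longleftrightarrow> (\<forall>xs a b ys. f (xs @ a # b # ys) = - f (xs @ b # a # ys))"

lemma alternatingD: "alternating f \<Longrightarrow> f (xs @ a # b # ys) = - f (xs @ b # a # ys)"
  unfolding alternating_def by blast

lemma alternating_swap: "alternating f \<Longrightarrow> f (a # b # ys) = - f (b # a # ys)"
  using alternatingD[of f "[]" a b ys] by (simp only: append_Nil)

lemma alternating_Cons: "alternating f \<Longrightarrow> alternating (\<lambda>t. f (a # t))"
  unfolding alternating_def by (metis append_Cons)

text \<open>Each letter of \<open>xs\<close> that \<open>y\<close> passes costs one sign. Absolute
  values are enough, because later it only matters whether a value vanishes.\<close>

lemma alternating_move:
  assumes "alternating f"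
  shows "\<bar>f (xs @ y # ys)\<bar> = \<bar>f (y # xs @ ys)\<bar>"
  using assms
proof (induction xs arbitrary: f)
  case (Cons x xs)
  have "\<bar>f (x # (xs @ y # ys))\<bar> = \<bar>f (x # y # xs @ ys)\<bar>"
    using Cons.IH[OF alternating_Cons[OF Cons.prems]] .
  thus ?case using alternating_swap[OF Cons.prems, of x y "xs @ ys"] by simp
qed simp

text \<open>Two equal letters can be brought to the front; exchanging them there negates the value
  but leaves the list unchanged.\<close>

lemma alternating_not_distinct:
  assumes f: "alternating f" and xs: "\<not> distinct xs"
  shows "f xs = 0"
proof -
  obtain as y bs cs where xs: "xs = as @ [y] @ bs @ [y] @ cs"
    using not_distinct_decomp[OF xs] by blast
  have "\<bar>f xs\<bar> = \<bar>f (y # (as @ bs) @ y # cs)\<bar>"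
    using alternating_move[OF f, of as y "bs @ y # cs"] by (simp add: xs)
  also have "\<dots> = \<bar>f (y # y # (as @ bs) @ cs)\<bar>"
    by (rule alternating_move[OF alternating_Cons[OF f]])
  also have "\<dots> = 0" using alternating_swap[OF f, of y y "(as @ bs) @ cs"] by simp
  finally show ?thesis by simp
qed

lemma alternating_abs_mset_eq:
  assumes "alternating f" "mset xs = mset ys"
  shows "\<bar>f xs\<bar> = \<bar>f ys\<bar>"
  using assms
proof (induction xs arbitrary: f ys)
  case (Cons x xs)
  have "x \<in> set ys" using Cons.prems(2) by (metis list.set_intros(1) set_mset_mset)
  then obtain as bs where ys: "ys = as @ x # bs" by (meson split_list)
  have "\<bar>f (x # xs)\<bar> = \<bar>f (x # as @ bs)\<bar>"
    using Cons.prems by (intro Cons.IH alternating_Cons) (auto simp: ys)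
  thus ?case using alternating_move[OF Cons.prems(1), of as x bs] ys by simp
qed simp

section \<open>Expansion of tensors in an orthonormal frame\<close>

text \<open>The second assumption is the completeness relation of the \<open>v j\<close>, the form
  in which Parseval's identity uses orthonormality. It will hold for the eigenvectors on the
  vertices and for those on the faces.\<close>

locale orthonormal_frame =
  fixes V :: "'a set" and n :: nat and v :: "nat \<Rightarrow> 'a \<Rightarrow> real"
  assumes finite_V: "finite V"
    and frame: "\<And>a b. a \<in> V \<Longrightarrow> b \<in> V \<Longrightarrow> (\<Sum>j<n. v j a * v j b) = (if a = b then 1 else 0)"
begin

lemma parseval:
  "(\<Sum>j<n. (\<Sum>a\<in>V. v j a * y a) * (\<Sum>a\<in>V. v j a * z a)) = (\<Sum>a\<in>V. y a * z a)"
proof -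
  have "(\<Sum>j<n. (\<Sum>a\<in>V. v j a * y a) * (\<Sum>a\<in>V. v j a * z a))
      = (\<Sum>j<n. \<Sum>a\<in>V. \<Sum>b\<in>V. (v j a * v j b) * (y a * z b))"
    unfolding sum_product by (intro sum.cong refl) (simp add: mult_ac)
  also have "\<dots> = (\<Sum>a\<in>V. \<Sum>b\<in>V. \<Sum>j<n. (v j a * v j b) * (y a * z b))"
    by (subst sum.swap, intro sum.cong refl sum.swap)
  also have "\<dots> = (\<Sum>a\<in>V. \<Sum>b\<in>V. if a = b then y a * z b else 0)"
    unfolding sum_distrib_right[symmetric] by (intro sum.cong refl) (simp add: frame)
  also have "\<dots> = (\<Sum>a\<in>V. y a * z a)" using finite_V by (simp add: sum.delta)
  finally show ?thesis .
qed

lemma quadratic_form_frame: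
  assumes S: "\<And>a b. a \<in> V \<Longrightarrow> b \<in> V \<Longrightarrow> S a b = (\<Sum>j<n. \<mu> j * (v j a * v j b))"
  shows "(\<Sum>j<n. \<mu> j * (\<Sum>a\<in>V. v j a * y a)\<^sup>2) = (\<Sum>a\<in>V. \<Sum>b\<in>V. S a b * (y a * y b))"
proof -
  have "(\<Sum>j<n. \<mu> j * (\<Sum>a\<in>V. v j a * y a)\<^sup>2)
      = (\<Sum>j<n. \<Sum>a\<in>V. \<Sum>b\<in>V. \<mu> j * (v j a * v j b) * (y a * y b))"
    unfolding power2_eq_square sum_product by (simp add: sum_distrib_left mult_ac)
  also have "\<dots> = (\<Sum>a\<in>V. \<Sum>b\<in>V. \<Sum>j<n. \<mu> j * (v j a * v j b) * (y a * y b))"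
    by (subst sum.swap, intro sum.cong refl sum.swap)
  also have "\<dots> = (\<Sum>a\<in>V. \<Sum>b\<in>V. S a b * (y a * y b))"
    unfolding sum_distrib_right[symmetric] by (intro sum.cong refl) (simp add: S)
  finally show ?thesis .
qed

text \<open>\<open>coef x J\<close> is the inner product of \<open>x\<close>, regarded as a tensor on \<open>V\<close>, with the elementary
  tensor \<open>v (J ! 0) \<otimes> v (J ! 1) \<otimes> \<dots>\<close>.\<close>

primrec coef :: "('a list \<Rightarrow> real) \<Rightarrow> nat list \<Rightarrow> real" where
  "coef x [] = x []"
| "coef x (j # J) = (\<Sum>a\<in>V. v j a * coef (\<lambda>t. x (a # t)) J)"

text \<open>Linearity in the tensor: the vanishing of a coefficient of an unknown combination
  becomes a linear equation in the weights \<open>z\<close>.\<close>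

lemma coef_sum: "coef (\<lambda>t. \<Sum>p\<in>P. z p * g p t) J = (\<Sum>p\<in>P. z p * coef (g p) J)"
proof (induction J arbitrary: g)
  case (Cons j J)
  have "coef (\<lambda>t. \<Sum>p\<in>P. z p * g p t) (j # J)
      = (\<Sum>a\<in>V. \<Sum>p\<in>P. z p * (v j a * coef (\<lambda>t. g p (a # t)) J))"
    unfolding coef.simps Cons.IH sum_distrib_left by (intro sum.cong refl) (simp only: mult.left_commute)
  also have "\<dots> = (\<Sum>p\<in>P. z p * coef (g p) (j # J))"
    by (subst sum.swap) (simp add: sum_distrib_left)
  finally show ?case .
qed simp

lemma coef_minus: "coef (\<lambda>t. - x t) J = - coef x J"
  by (induction J arbitrary: x) (simp_all add: sum_negf)

text \<open>Exchanging two adjacent indices amounts to exchanging the two summation letters paired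
  with them, which costs a sign in \<open>x\<close>.\<close>

lemma alternating_coef:
  assumes "alternating x"
  shows "alternating (coef x)"
proof -
  have "coef x (I @ i # j # J) = - coef x (I @ j # i # J)" if "alternating x" for I i j J x
    using that
  proof (induction I arbitrary: x)
    case Nil
    have swap: "coef (\<lambda>t. x (a # b # t)) J = - coef (\<lambda>t. x (b # a # t)) J" for a b
    proof -
      have "(\<lambda>t. x (a # b # t)) = (\<lambda>t. - x (b # a # t))" by (rule ext) (rule alternating_swap[OF Nil])
      thus ?thesis by (simp only: coef_minus)
    qed
    have "v i a * (v j b * coef (\<lambda>t. x (a # b # t)) J)
        = - (v j b * (v i a * coef (\<lambda>t. x (b # a # t)) J))" for a b
      unfolding swap[of a b] by simp
    hence "(\<Sum>a\<in>V. \<Sum>b\<in>V. v i a * (v j b * coef (\<lambda>t. x (a # b # t)) J))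
        = - (\<Sum>a\<in>V. \<Sum>b\<in>V. v j b * (v i a * coef (\<lambda>t. x (b # a # t)) J))"
      by (simp only: sum_negf)
    also have "\<dots> = - (\<Sum>b\<in>V. \<Sum>a\<in>V. v j b * (v i a * coef (\<lambda>t. x (b # a # t)) J))"
      by (subst sum.swap) simp
    finally show ?case by (simp add: sum_distrib_left)
  next
    case (Cons p I)
    have "coef (\<lambda>t. x (a # t)) (I @ i # j # J) = - coef (\<lambda>t. x (a # t)) (I @ j # i # J)" for a
      by (rule Cons.IH[OF alternating_Cons[OF Cons.prems]])
    thus ?case by (simp add: sum_negf)
  qed
  thus ?thesis using assms unfolding alternating_def by blast
qed

text \<open>Parseval's identity for vectors treats the first tensor factor; the induction hypothesis
  treats the slices of \<open>x\<close> and \<open>y\<close> at a fixed first letter.\<close>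

lemma coef_parseval:
  "(\<Sum>J\<in>words {..<n} m. coef x J * coef y J) = (\<Sum>t\<in>words V m. x t * y t)"
proof (induction m arbitrary: x y)
  case (Suc m)
  have "(\<Sum>J\<in>words {..<n} (Suc m). coef x J * coef y J)
      = (\<Sum>J\<in>words {..<n} m. \<Sum>j<n. coef x (j # J) * coef y (j # J))"
    unfolding sum_words_Suc by (rule sum.swap)
  also have "\<dots> = (\<Sum>J\<in>words {..<n} m. \<Sum>a\<in>V. coef (\<lambda>t. x (a # t)) J * coef (\<lambda>t. y (a # t)) J)"
    by (simp add: parseval)
  also have "\<dots> = (\<Sum>a\<in>V. \<Sum>t\<in>words V m. x (a # t) * y (a # t))"
    by (subst sum.swap) (simp add: Suc)
  finally show ?case by (simp add: sum_words_Suc)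
qed simp

text \<open>The left-hand side is the quadratic form at \<open>x\<close> of the sum of the operators that apply \<open>S\<close> to
  one tensor factor. On alternating tensors all the factors contribute equally.\<close>

lemma coef_energy:
  assumes S: "\<And>a b. a \<in> V \<Longrightarrow> b \<in> V \<Longrightarrow> S a b = (\<Sum>j<n. \<mu> j * (v j a * v j b))"
    and "alternating x"
  shows "(\<Sum>J\<in>words {..<n} (Suc m). sum_list (map \<mu> J) * (coef x J)\<^sup>2)
    = real (Suc m) * (\<Sum>t\<in>words V m. \<Sum>a\<in>V. \<Sum>b\<in>V. S a b * (x (a # t) * x (b # t)))"
proof -
  have form: "(\<Sum>j<n. \<mu> j * (\<Sum>a\<in>V. v j a * y a)\<^sup>2) = (\<Sum>a\<in>V. \<Sum>b\<in>V. S a b * (y a * y b))" for y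
    by (rule quadratic_form_frame) (rule S)
  \<comment> \<open>Split the eigenvalue sum of \<open>j # J\<close> into \<open>\<mu> j\<close> and
    the rest. The first part gives the form of \<open>S\<close> in the first factor; in the second,
    Parseval's identity removes \<open>j\<close> and leaves the slices of \<open>x\<close>.\<close>
  have step: "(\<Sum>J\<in>words {..<n} (Suc m). sum_list (map \<mu> J) * (coef x J)\<^sup>2)
    = (\<Sum>t\<in>words V m. \<Sum>a\<in>V. \<Sum>b\<in>V. S a b * (x (a # t) * x (b # t)))
      + (\<Sum>a\<in>V. \<Sum>J\<in>words {..<n} m. sum_list (map \<mu> J) * (coef (\<lambda>t. x (a # t)) J)\<^sup>2)" for m x
  proof -
    define c where "c = (\<lambda>a. coef (\<lambda>t. x (a # t)))"
    have norm: "(\<Sum>j<n. (\<Sum>a\<in>V. v j a * c a J)\<^sup>2) = (\<Sum>a\<in>V. (c a J)\<^sup>2)" for J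
      using parseval[of "\<lambda>a. c a J" "\<lambda>a. c a J"] by (simp only: power2_eq_square)
    have "(\<Sum>J\<in>words {..<n} (Suc m). sum_list (map \<mu> J) * (coef x J)\<^sup>2)
      = (\<Sum>J\<in>words {..<n} m. (\<Sum>j<n. \<mu> j * (\<Sum>a\<in>V. v j a * c a J)\<^sup>2)
          + sum_list (map \<mu> J) * (\<Sum>j<n. (\<Sum>a\<in>V. v j a * c a J)\<^sup>2))"
      unfolding sum_words_Suc
      by (subst sum.swap) (simp add: c_def sum.distrib sum_distrib_left distrib_right)
    also have "\<dots> = (\<Sum>J\<in>words {..<n} m. \<Sum>a\<in>V. \<Sum>b\<in>V. S a b * (c a J * c b J))
        + (\<Sum>J\<in>words {..<n} m. \<Sum>a\<in>V. sum_list (map \<mu> J) * (c a J)\<^sup>2)"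
      unfolding form norm sum.distrib sum_distrib_left ..
    also have "(\<Sum>J\<in>words {..<n} m. \<Sum>a\<in>V. \<Sum>b\<in>V. S a b * (c a J * c b J))
        = (\<Sum>a\<in>V. \<Sum>b\<in>V. S a b * (\<Sum>J\<in>words {..<n} m. c a J * c b J))"
      unfolding sum_distrib_left by (subst sum.swap, intro sum.cong refl sum.swap)
    also have "\<dots> = (\<Sum>a\<in>V. \<Sum>b\<in>V. \<Sum>t\<in>words V m. S a b * (x (a # t) * x (b # t)))"
      unfolding c_def coef_parseval sum_distrib_left ..
    also have "\<dots> = (\<Sum>a\<in>V. \<Sum>t\<in>words V m. \<Sum>b\<in>V. S a b * (x (a # t) * x (b # t)))"
      by (intro sum.cong refl sum.swap)
    also have "\<dots> = (\<Sum>t\<in>words V m. \<Sum>a\<in>V. \<Sum>b\<in>V. S a b * (x (a # t) * x (b # t)))"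
      by (rule sum.swap)
    also have "(\<Sum>J\<in>words {..<n} m. \<Sum>a\<in>V. sum_list (map \<mu> J) * (c a J)\<^sup>2)
        = (\<Sum>a\<in>V. \<Sum>J\<in>words {..<n} m. sum_list (map \<mu> J) * (c a J)\<^sup>2)"
      by (rule sum.swap)
    finally show ?thesis by (simp add: c_def)
  qed
  show ?thesis using assms(2)
  proof (induction m arbitrary: x)
    case 0
    show ?case using step[of x 0] by simp
  next
    case (Suc m)
    let ?Q = "\<lambda>m. \<Sum>t\<in>words V m. \<Sum>a\<in>V. \<Sum>b\<in>V. S a b * (x (a # t) * x (b # t))"
    have "(\<Sum>J\<in>words {..<n} (Suc m). sum_list (map \<mu> J) * (coef (\<lambda>t. x (a # t)) J)\<^sup>2)
        = real (Suc m) * (\<Sum>t\<in>words V m. \<Sum>b\<in>V. \<Sum>c\<in>V. S b c * (x (b # a # t) * x (c # a # t)))" for a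
    proof -
      \<comment> \<open>The induction hypothesis applies \<open>S\<close> to the second letter; two
        sign changes cancel and move it to the first.\<close>
      have swap: "x (a # b # t) * x (a # c # t) = x (b # a # t) * x (c # a # t)" for b c t
        using alternating_swap[OF Suc.prems, of a b t] alternating_swap[OF Suc.prems, of a c t] by simp
      show ?thesis using Suc.IH[OF alternating_Cons[OF Suc.prems], of a] by (simp only: swap)
    qed
    hence "(\<Sum>a\<in>V. \<Sum>J\<in>words {..<n} (Suc m). sum_list (map \<mu> J) * (coef (\<lambda>t. x (a # t)) J)\<^sup>2)
        = real (Suc m) * ?Q (Suc m)"
      unfolding sum_words_Suc[where h = "\<lambda>t. \<Sum>a\<in>V. \<Sum>b\<in>V. S a b * (x (a # t) * x (b # t))"]
      by (simp only: sum_distrib_left)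
    thus ?case unfolding step[of x "Suc m"]
      by (simp only: of_nat_Suc[of "Suc m"] distrib_right mult_1)
  qed
qed

text \<open>In the expansion over index words, those with a repeated index drop out by alternation
  and those with index set in \<open>T\<close> by assumption. Every surviving eigenvalue sum is at
  most \<open>s\<close>.\<close>

lemma coef_energy_le:
  assumes S: "\<And>a b. a \<in> V \<Longrightarrow> b \<in> V \<Longrightarrow> S a b = (\<Sum>j<n. \<mu> j * (v j a * v j b))"
    and x: "alternating x"
    and T: "\<And>J. J \<in> T \<Longrightarrow> coef x (sorted_list_of_set J) = 0"
    and s: "\<And>J. J \<in> nsets {..<n} (Suc k) \<Longrightarrow> J \<notin> T \<Longrightarrow> (\<Sum>j\<in>J. \<mu> j) \<le> s"
  shows "real (Suc k) * (\<Sum>t\<in>words V k. \<Sum>a\<in>V. \<Sum>b\<in>V. S a b * (x (a # t) * x (b # t)))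
    \<le> s * (\<Sum>t\<in>words V (Suc k). (x t)\<^sup>2)"
proof -
  have "sum_list (map \<mu> J) * (coef x J)\<^sup>2 \<le> s * (coef x J)\<^sup>2" if J: "J \<in> words {..<n} (Suc k)" for J
  proof (cases "distinct J \<and> set J \<notin> T")
    case True
    hence "set J \<in> nsets {..<n} (Suc k)"
      using J by (auto simp: nsets_def words_def distinct_card)
    hence "sum_list (map \<mu> J) \<le> s" using s True by (simp add: sum_list_distinct_conv_sum_set)
    thus ?thesis by (intro mult_right_mono) auto
  next
    case False
    have "coef x J = 0"
    proof (cases "distinct J")
      case True
      \<comment> \<open>\<open>T\<close> is tested on the sorted word only; any other order of the
        same indices changes at most the sign.\<close>
      hence "mset J = mset (sorted_list_of_set (set J))"
        by (metis distinct_sorted_list_of_set finite_set set_eq_iff_mset_eq_distinct set_sorted_list_of_set)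
      hence "\<bar>coef x J\<bar> = \<bar>coef x (sorted_list_of_set (set J))\<bar>"
        by (rule alternating_abs_mset_eq[OF alternating_coef[OF x]])
      thus ?thesis using T False True by simp
    qed (rule alternating_not_distinct[OF alternating_coef[OF x]])
    thus ?thesis by simp
  qed
  hence "(\<Sum>J\<in>words {..<n} (Suc k). sum_list (map \<mu> J) * (coef x J)\<^sup>2)
      \<le> s * (\<Sum>J\<in>words {..<n} (Suc k). (coef x J)\<^sup>2)"
    unfolding sum_distrib_left by (rule sum_mono)
  also have "(\<Sum>J\<in>words {..<n} (Suc k). (coef x J)\<^sup>2) = (\<Sum>t\<in>words V (Suc k). (x t)\<^sup>2)"
    using coef_parseval[of x x] by (simp add: power2_eq_square)
  finally show ?thesis by (simp only: coef_energy[OF S x])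
qed

end

section \<open>Functions on subsets as alternating tensors\<close>

definition osgn :: "'a::linorder \<Rightarrow> 'a \<Rightarrow> real" where
  "osgn a b = (if a < b then 1 else if b < a then - 1 else 0)"

text \<open>The sign of the permutation that sorts the list, and 0 if a letter repeats: the
  Levi-Civita symbol for an ordered alphabet.\<close>

primrec lsign :: "'a::linorder list \<Rightarrow> real" where
  "lsign [] = 1"
| "lsign (a # t) = (\<Prod>b\<leftarrow>t. osgn a b) * lsign t"

lemma osgn_swap: "osgn a b = - osgn b a"
  by (auto simp: osgn_def)

lemma lsign_swap: "lsign (xs @ a # b # ys) = - lsign (xs @ b # a # ys)"
proof (induction xs)
  case Nil
  show ?case by (simp add: osgn_swap[of a b])
qed simp

text \<open>The set of letters ignores their order, so all antisymmetry comes from the sign. This is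
  how a function on subsets becomes an alternating tensor.\<close>

lemma alternating_lsign: "alternating (\<lambda>t. lsign t * f (set t))"
  unfolding alternating_def
proof (intro allI)
  fix xs a b and ys :: "'a list"
  have "set (xs @ a # b # ys) = set (xs @ b # a # ys)" by auto
  thus "lsign (xs @ a # b # ys) * f (set (xs @ a # b # ys)) = - (lsign (xs @ b # a # ys) * f (set (xs @ b # a # ys)))"
    using lsign_swap[of xs a b ys] by (simp only: mult_minus_left)
qed

lemma lsign_square: "(lsign t)\<^sup>2 = (if distinct t then 1 else 0)"
proof (induction t)
  case (Cons a t)
  have "(\<Prod>b\<leftarrow>t. osgn a b)\<^sup>2 = (if a \<in> set t then 0 else 1)"
    by (induction t) (auto simp: osgn_def power_mult_distrib)
  thus ?case using Cons by (simp add: power_mult_distrib)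
qed simp

text \<open>Group the distinct words by their set of letters; each \<open>k\<close>-subset has
  \<open>fact k\<close> orderings.\<close>

lemma sum_words_distinct:
  assumes "finite V"
  shows "(\<Sum>t\<in>words V k. if distinct t then g (set t) else 0) = fact k * (\<Sum>\<rho>\<in>nsets V k. (g \<rho> :: real))"
proof -
  have "(\<Sum>t\<in>words V k. if distinct t then g (set t) else 0) = (\<Sum>t\<in>{t \<in> words V k. distinct t}. g (set t))"
    by (subst sum.inter_filter[OF finite_words[OF assms]]) simp
  also have "\<dots> = (\<Sum>\<rho>\<in>nsets V k. \<Sum>t\<in>{t \<in> {t \<in> words V k. distinct t}. set t = \<rho>}. g (set t))"
  proof (rule sum.group[symmetric])
    show "finite {t \<in> words V k. distinct t}" using finite_words[OF assms] by simp
    show "finite (nsets V k)" using assms by (rule finite_imp_finite_nsets)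
    show "set ` {t \<in> words V k. distinct t} \<subseteq> nsets V k"
      by (auto simp: nsets_def words_def distinct_card)
  qed
  also have "\<dots> = (\<Sum>\<rho>\<in>nsets V k. fact k * g \<rho>)"
  proof (rule sum.cong[OF refl])
    fix \<rho> assume \<rho>: "\<rho> \<in> nsets V k"
    have eq: "{t \<in> {t \<in> words V k. distinct t}. set t = \<rho>} = permutations_of_set \<rho>"
      using \<rho> by (auto simp: words_def nsets_def permutations_of_set_def distinct_card)
    have "(\<Sum>t\<in>permutations_of_set \<rho>. g (set t)) = (\<Sum>t\<in>permutations_of_set \<rho>. g \<rho>)"
      by (rule sum.cong) (auto simp: permutations_of_set_def)
    thus "(\<Sum>t\<in>{t \<in> {t \<in> words V k. distinct t}. set t = \<rho>}. g (set t)) = fact k * g \<rho>"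
      unfolding eq using \<rho> by (simp add: nsets_def)
  qed
  finally show ?thesis by (simp add: sum_distrib_left)
qed

text \<open>The left-hand side is the quadratic form of the additive compound: \<open>\<rho>\<close>
  is the part kept, one vertex \<open>b\<close> is exchanged for \<open>a\<close>, and the
  \<open>osgn\<close> product is the resulting sign. The tensor estimate is applied to
  \<open>f\<close> made alternating.\<close>

lemma compound_form_le:
  fixes V :: "'a::linorder set"
  assumes "orthonormal_frame V n v"
    and S: "\<And>a b. a \<in> V \<Longrightarrow> b \<in> V \<Longrightarrow> S a b = (\<Sum>j<n. \<mu> j * (v j a * v j b))"
    and T: "\<And>J. J \<in> T \<Longrightarrow>
      orthonormal_frame.coef V v (\<lambda>t. lsign t * f (set t)) (sorted_list_of_set J) = 0"
    and s: "\<And>J. J \<in> nsets {..<n} (Suc k) \<Longrightarrow> J \<notin> T \<Longrightarrow> (\<Sum>j\<in>J. \<mu> j) \<le> s"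
  shows "(\<Sum>\<rho>\<in>nsets V k. \<Sum>a\<in>V. \<Sum>b\<in>V. S a b *
      ((\<Prod>y\<in>\<rho>. osgn a y * osgn b y) * (f (insert a \<rho>) * f (insert b \<rho>))))
    \<le> s * (\<Sum>\<sigma>\<in>nsets V (Suc k). (f \<sigma>)\<^sup>2)" (is "?Q \<le> s * ?N")
proof -
  interpret orthonormal_frame V n v by fact
  define x where "x = (\<lambda>t. lsign t * f (set t))"
  have sq: "lsign t * lsign t = (if distinct t then 1 else 0)" for t :: "'a list"
    using lsign_square[of t] by (simp add: power2_eq_square)
  \<comment> \<open>The sign of the common tail \<open>t\<close> occurs twice and cancels, leaving
    only the positions of \<open>a\<close> and \<open>b\<close> relative to
    \<open>t\<close>.\<close>
  have prod: "x (a # t) * x (b # t) = (if distinct t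
      then (\<Prod>y\<in>set t. osgn a y * osgn b y) * (f (insert a (set t)) * f (insert b (set t))) else 0)"
    for a b t
  proof -
    have "x (a # t) * x (b # t) = ((\<Prod>y\<leftarrow>t. osgn a y) * (\<Prod>y\<leftarrow>t. osgn b y)) * (lsign t * lsign t)
        * (f (insert a (set t)) * f (insert b (set t)))"
      by (simp add: x_def)
    thus ?thesis unfolding sq by (simp add: prod.distrib prod.distinct_set_conv_list)
  qed
  have "(\<Sum>t\<in>words V k. \<Sum>a\<in>V. \<Sum>b\<in>V. S a b * (x (a # t) * x (b # t)))
      = (\<Sum>t\<in>words V k. if distinct t then \<Sum>a\<in>V. \<Sum>b\<in>V. S a b *
      ((\<Prod>y\<in>set t. osgn a y * osgn b y) * (f (insert a (set t)) * f (insert b (set t)))) else 0)"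
    unfolding prod by (rule sum.cong) auto
  also have "\<dots> = fact k * ?Q" by (rule sum_words_distinct[OF finite_V])
  finally have 1: "(\<Sum>t\<in>words V k. \<Sum>a\<in>V. \<Sum>b\<in>V. S a b * (x (a # t) * x (b # t))) = fact k * ?Q" .
  have "(\<Sum>t\<in>words V (Suc k). (x t)\<^sup>2) = (\<Sum>t\<in>words V (Suc k). if distinct t then (f (set t))\<^sup>2 else 0)"
    by (rule sum.cong) (auto simp: x_def power_mult_distrib lsign_square)
  also have "\<dots> = fact (Suc k) * ?N" by (rule sum_words_distinct[OF finite_V])
  finally have 2: "(\<Sum>t\<in>words V (Suc k). (x t)\<^sup>2) = fact (Suc k) * ?N" .
  have x: "alternating x" unfolding x_def by (rule alternating_lsign)
  \<comment> \<open>The factor \<open>Suc k\<close> of the energy identity turns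
    \<open>fact k\<close> into \<open>fact (Suc k)\<close>, so both sides carry the same
    factorial.\<close>
  have "real (Suc k) * (fact k * ?Q) \<le> s * (fact (Suc k) * ?N)"
    unfolding 1[symmetric] 2[symmetric]
    by (rule coef_energy_le[OF S x T[folded x_def] s])
  hence "fact (Suc k) * ?Q \<le> fact (Suc k) * (s * ?N)" by (simp only: fact_Suc mult_ac of_nat_mult)
  thus ?thesis by simp
qed

section \<open>The symmetrized Laplacians\<close>

lemma sum_UN_le:
  fixes g :: "'b \<Rightarrow> real"
  assumes "finite I" "\<And>i. i \<in> I \<Longrightarrow> finite (N i)" "\<And>i x. i \<in> I \<Longrightarrow> x \<in> N i \<Longrightarrow> g x \<ge> 0"
  shows "sum g (\<Union>i\<in>I. N i) \<le> (\<Sum>i\<in>I. sum g (N i))"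
  using assms
proof (induction I rule: finite_induct)
  case (insert i I)
  have "sum g (\<Union>i\<in>insert i I. N i) \<le> sum g (N i) + sum g (\<Union>i\<in>I. N i)"
  proof -
    have "0 \<le> sum g (N i \<inter> (\<Union>i\<in>I. N i))" using insert.prems by (intro sum_nonneg) auto
    thus ?thesis using insert.hyps insert.prems sum.union_inter[of "N i" "\<Union>i\<in>I. N i" g] by auto
  qed
  moreover have "sum g (\<Union>i\<in>I. N i) \<le> (\<Sum>i\<in>I. sum g (N i))"
    by (rule insert.IH) (use insert.prems in auto)
  ultimately show ?case using insert.hyps by simp
qed simp

text \<open>For positive weights, the graph Laplacian conjugated by the diagonal matrix of
  \<open>sqrt (w u)\<close>. The formula still makes sense when weights are zero.\<close>

definition graph_form :: "'a set set \<Rightarrow> ('a \<Rightarrow> real) \<Rightarrow> 'a \<Rightarrow> 'a \<Rightarrow> real" where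
  "graph_form E w u v = (if u = v then \<Sum>u'\<in>nbrs E u. w u'
     else if {u, v} \<in> E then - sqrt (w u * w v) else 0)"

text \<open>For positive weights, the complex Laplacian conjugated by the diagonal matrix with entry
  \<open>\<Prod>v\<in>\<sigma>. sqrt (w v)\<close> at \<open>\<sigma>\<close>.\<close>

definition complex_form :: "'a::linorder set set \<Rightarrow> ('a \<Rightarrow> real) \<Rightarrow> nat \<Rightarrow> 'a set \<Rightarrow> 'a set \<Rightarrow> real" where
  "complex_form X w k \<sigma> \<tau> = (if \<sigma> = \<tau> then (\<Sum>u\<in>face_nbrs X \<sigma>. w u) + (\<Sum>v\<in>\<sigma>. w v)
     else if card (\<sigma> \<inter> \<tau>) = k \<and> \<sigma> \<union> \<tau> \<notin> X
       then (- 1) ^ eps \<sigma> \<tau> * sqrt (w (the_elem (\<sigma> - \<tau>)) * w (the_elem (\<tau> - \<sigma>)))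
     else 0)"

text \<open>The chosen enumeration depends on \<open>I\<close> alone, so a single list serves all
  matrices indexed by \<open>I\<close>.\<close>

lemma mat_on_some_list:
  assumes "finite I"
  obtains xs where "distinct xs" "set xs = I" "\<And>A. mat_on I A = mat_of_list xs A"
proof -
  have "\<exists>xs. distinct xs \<and> set xs = I" using finite_distinct_list[OF assms] by blast
  from someI_ex[OF this] show ?thesis using that unfolding mat_on_def by blast
qed

section \<open>Passage from the Laplacians to their symmetric forms\<close>

lemma eigs_graph_laplacian:
  assumes "finite V" and w: "\<And>v. v \<in> V \<Longrightarrow> w v \<ge> 0"
  shows "eigs (graph_laplacian V E w) = eigs (mat_on V (graph_form E w))"
proof -
  obtain xs where xs: "set xs = V" "\<And>A. mat_on V A = mat_of_list xs A"
    using mat_on_some_list[OF assms(1)] by metis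
  \<comment> \<open>\<open>A e\<close> has the entries of the Laplacian for the weights shifted by
    \<open>e\<close>; these are positive for \<open>e > 0\<close>, which makes the scaling
    invertible.\<close>
  define A where "A = (\<lambda>e :: real. \<lambda>u v. if u = v then \<Sum>u'\<in>nbrs E u. w u' + e
     else if {u, v} \<in> E then - (w v + e) else 0)"
  have pos: "w a + e > 0" if "a \<in> V" "e > 0" for a e using w[OF that(1)] that(2) by linarith
  have "char_poly (mat_of_list xs (A 0)) = char_poly (mat_of_list xs (graph_form E (\<lambda>v. w v + 0)))"
  proof (rule char_poly_mat_of_list_scale_limit[where h = "\<lambda>e a. sqrt (w a + e)"
      and B = "\<lambda>e. graph_form E (\<lambda>v. w v + e)"])
    fix e :: real and a b assume e: "e > 0" and ab: "a \<in> set xs" "b \<in> set xs"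
    show "graph_form E (\<lambda>v. w v + e) a b * sqrt (w b + e) = sqrt (w a + e) * A e a b"
    proof (cases "a \<noteq> b \<and> {a, b} \<in> E")
      case True
      have "sqrt (w b + e) * sqrt (w b + e) = w b + e" using pos[of b e] e ab xs by simp
      moreover have "graph_form E (\<lambda>v. w v + e) a b = - (sqrt (w a + e) * sqrt (w b + e))"
        "A e a b = - (w b + e)"
        using True by (simp_all only: graph_form_def A_def real_sqrt_mult if_False if_True simp_thms)
      ultimately show ?thesis by (simp only: mult_minus_left mult_minus_right mult.assoc)
    qed (auto simp: graph_form_def A_def)
  next
    fix e :: real and a assume "e > 0" "a \<in> set xs"
    thus "sqrt (w a + e) \<noteq> 0" using pos[of a e] xs by auto
  next
    fix a b
    show "continuous_on UNIV (\<lambda>e. A e a b)"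
      unfolding A_def by (cases "a = b"; cases "{a, b} \<in> E"; simp only: if_True if_False simp_thms; intro continuous_intros)
    show "continuous_on UNIV (\<lambda>e. graph_form E (\<lambda>v. w v + e) a b)"
      unfolding graph_form_def by (cases "a = b"; cases "{a, b} \<in> E"; simp only: if_True if_False simp_thms; intro continuous_intros)
  qed
  from this[unfolded A_def add_0_right] show ?thesis
    unfolding eigs_def graph_laplacian_def xs(2) by (simp only:)
qed

lemma card_inter_pairE:
  assumes "card \<sigma> = Suc k" "card \<tau> = Suc k" "card (\<sigma> \<inter> \<tau>) = k"
  obtains a b where "\<sigma> - \<tau> = {a}" "\<tau> - \<sigma> = {b}" "\<sigma> = insert a (\<sigma> \<inter> \<tau>)" "\<tau> = insert b (\<sigma> \<inter> \<tau>)"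
proof -
  have fin: "finite \<sigma>" "finite \<tau>" by (rule card_ge_0_finite, simp add: assms)+
  have "card (\<sigma> - \<tau>) = 1" "card (\<tau> - \<sigma>) = 1"
    using assms fin card_Diff_subset_Int[of \<sigma> \<tau>] card_Diff_subset_Int[of \<tau> \<sigma>]
    by (simp_all add: Int_commute)
  then obtain a b where ab: "\<sigma> - \<tau> = {a}" "\<tau> - \<sigma> = {b}" by (metis card_1_singletonE)
  hence "\<sigma> = insert a (\<sigma> \<inter> \<tau>)" "\<tau> = insert b (\<sigma> \<inter> \<tau>)" by auto
  with ab show ?thesis by (rule that)
qed

lemma eigs_complex_laplacian:
  fixes V :: "'a::linorder set"
  assumes "finite V" and XV: "\<And>\<sigma>. \<sigma> \<in> X \<Longrightarrow> \<sigma> \<subseteq> V" and w: "\<And>v. v \<in> V \<Longrightarrow> w v \<ge> 0"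
  shows "eigs (complex_laplacian X w k) = eigs (mat_on (faces X k) (complex_form X w k))"
proof -
  have "finite (faces X k)"
    by (rule finite_subset[of _ "Pow V"]) (use XV assms(1) in \<open>auto simp: faces_def\<close>)
  then obtain xs where xs: "set xs = faces X k" "\<And>A. mat_on (faces X k) A = mat_of_list xs A"
    using mat_on_some_list by metis
  define A where "A = (\<lambda>e :: real. \<lambda>\<sigma> \<tau>. if \<sigma> = \<tau> then (\<Sum>u\<in>face_nbrs X \<sigma>. w u + e) + (\<Sum>v\<in>\<sigma>. w v + e)
     else if card (\<sigma> \<inter> \<tau>) = k \<and> \<sigma> \<union> \<tau> \<notin> X then (- 1) ^ eps \<sigma> \<tau> * (w (the_elem (\<tau> - \<sigma>)) + e)
     else 0)"
  have pos: "w a + e > 0" if "a \<in> V" "e > 0" for a e using w[OF that(1)] that(2) by linarith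
  have "char_poly (mat_of_list xs (A 0)) = char_poly (mat_of_list xs (complex_form X (\<lambda>v. w v + 0) k))"
  proof (rule char_poly_mat_of_list_scale_limit[where h = "\<lambda>e \<sigma>. \<Prod>v\<in>\<sigma>. sqrt (w v + e)"
      and B = "\<lambda>e. complex_form X (\<lambda>v. w v + e) k"])
    fix e :: real and \<sigma> \<tau> assume e: "e > 0" and "\<sigma> \<in> set xs" "\<tau> \<in> set xs"
    hence \<sigma>\<tau>: "\<sigma> \<subseteq> V" "\<tau> \<subseteq> V" "card \<sigma> = Suc k" "card \<tau> = Suc k"
      using xs XV by (auto simp: faces_def)
    have fin: "finite (\<sigma> \<inter> \<tau>)" using \<sigma>\<tau> assms(1) finite_subset by blast
    let ?h = "\<lambda>\<sigma>. \<Prod>v\<in>\<sigma>. sqrt (w v + e)"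
    show "complex_form X (\<lambda>v. w v + e) k \<sigma> \<tau> * ?h \<tau> = ?h \<sigma> * A e \<sigma> \<tau>"
    proof (cases "\<sigma> \<noteq> \<tau> \<and> card (\<sigma> \<inter> \<tau>) = k \<and> \<sigma> \<union> \<tau> \<notin> X")
      case True
      then obtain a b where ab: "\<sigma> - \<tau> = {a}" "\<tau> - \<sigma> = {b}"
        "\<sigma> = insert a (\<sigma> \<inter> \<tau>)" "\<tau> = insert b (\<sigma> \<inter> \<tau>)"
        using card_inter_pairE \<sigma>\<tau>(3,4) by metis
      have abV: "a \<in> V" "b \<in> V" "a \<notin> \<sigma> \<inter> \<tau>" "b \<notin> \<sigma> \<inter> \<tau>" using ab(1,2) \<sigma>\<tau> by auto
      \<comment> \<open>The common vertices contribute the same factor to both scalings, so only the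
        exchanged vertices \<open>a\<close> and \<open>b\<close> matter.\<close>
      have h: "?h \<sigma> = sqrt (w a + e) * ?h (\<sigma> \<inter> \<tau>)" "?h \<tau> = sqrt (w b + e) * ?h (\<sigma> \<inter> \<tau>)"
        using prod.insert[OF fin abV(3), of "\<lambda>v. sqrt (w v + e)"]
          prod.insert[OF fin abV(4), of "\<lambda>v. sqrt (w v + e)"] ab(3,4) by simp_all
      have "complex_form X (\<lambda>v. w v + e) k \<sigma> \<tau> = (- 1) ^ eps \<sigma> \<tau> * sqrt ((w a + e) * (w b + e))"
        "A e \<sigma> \<tau> = (- 1) ^ eps \<sigma> \<tau> * (w b + e)"
        using True ab(1,2) by (simp_all add: complex_form_def A_def)
      thus ?thesis unfolding h using pos[OF abV(1) e] pos[OF abV(2) e] by (simp add: real_sqrt_mult)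
    qed (auto simp: complex_form_def A_def)
  next
    fix e :: real and \<sigma> assume e: "e > 0" and "\<sigma> \<in> set xs"
    hence "\<sigma> \<subseteq> V" using xs XV by (auto simp: faces_def)
    thus "(\<Prod>v\<in>\<sigma>. sqrt (w v + e)) \<noteq> 0"
      using pos e finite_subset[OF _ assms(1)] by (force simp: prod_zero_iff)
  next
    fix \<sigma> \<tau>
    show "continuous_on UNIV (\<lambda>e. A e \<sigma> \<tau>)"
      unfolding A_def by (cases "\<sigma> = \<tau>"; cases "card (\<sigma> \<inter> \<tau>) = k \<and> \<sigma> \<union> \<tau> \<notin> X"; simp only: if_True if_False simp_thms; intro continuous_intros)
    show "continuous_on UNIV (\<lambda>e. complex_form X (\<lambda>v. w v + e) k \<sigma> \<tau>)"
      unfolding complex_form_def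
      by (cases "\<sigma> = \<tau>"; cases "card (\<sigma> \<inter> \<tau>) = k \<and> \<sigma> \<union> \<tau> \<notin> X"; simp only: if_True if_False simp_thms; intro continuous_intros)
  qed
  from this[unfolded A_def add_0_right] show ?thesis
    unfolding eigs_def complex_laplacian_def xs(2) by (simp only:)
qed

section \<open>Comparison of the two quadratic forms\<close>

lemma prod_osgn_eq_0: "finite \<rho> \<Longrightarrow> a \<in> \<rho> \<or> b \<in> \<rho> \<Longrightarrow> (\<Prod>y\<in>\<rho>. osgn a y * osgn b y) = 0"
  by (auto simp: prod_zero_iff osgn_def)

lemma prod_osgn_self:
  assumes "finite \<rho>"
  shows "(\<Prod>y\<in>\<rho>. osgn a y * osgn a y) = (if a \<in> \<rho> then 0 else 1)"
proof (cases "a \<in> \<rho>")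
  case False
  hence "(\<Prod>y\<in>\<rho>. osgn a y * osgn a y) = 1" by (intro prod.neutral) (auto simp: osgn_def)
  thus ?thesis using False by simp
qed (simp only: prod_osgn_eq_0[OF assms] simp_thms if_True)

text \<open>For \<open>y\<close> in \<open>\<rho>\<close>, \<open>osgn a y * osgn b y\<close> is -1
  exactly when \<open>y\<close> lies between \<open>a\<close> and \<open>b\<close>. So the sign of
  the compound is the sign given by \<open>eps\<close>.\<close>

lemma complex_form_insert:
  assumes "finite \<rho>" "card \<rho> = k" "a \<notin> \<rho>" "b \<notin> \<rho>" "a \<noteq> b" "insert a (insert b \<rho>) \<notin> X"
  shows "complex_form X w k (insert a \<rho>) (insert b \<rho>)
    = (\<Prod>y\<in>\<rho>. osgn a y * osgn b y) * sqrt (w a * w b)"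
proof -
  have sets: "insert a \<rho> - insert b \<rho> = {a}" "insert b \<rho> - insert a \<rho> = {b}"
    "insert a \<rho> \<inter> insert b \<rho> = \<rho>" "insert a \<rho> \<union> insert b \<rho> = insert a (insert b \<rho>)"
    "insert a \<rho> \<noteq> insert b \<rho>"
    using assms by auto
  have "(\<Prod>y\<in>\<rho>. osgn a y * osgn b y) = (\<Prod>y\<in>\<rho>. if min a b < y \<and> y < max a b then - 1 else 1)"
    using assms(3-5) by (intro prod.cong) (auto simp: osgn_def min_def max_def)
  also have "\<dots> = (- 1) ^ eps (insert a \<rho>) (insert b \<rho>)"
  proof -
    have "eps (insert a \<rho>) (insert b \<rho>) = card {y \<in> \<rho>. min a b < y \<and> y < max a b}"
      by (simp only: eps_def sets Let_def the_elem_eq)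
    also have "{y \<in> \<rho>. min a b < y \<and> y < max a b} = \<rho> \<inter> {y. min a b < y \<and> y < max a b}" by blast
    finally show ?thesis using assms(1) by (simp add: prod.If_cases)
  qed
  finally show ?thesis using assms(2,6) by (simp add: complex_form_def sets insert_commute[of b a])
qed

lemma complex_form_sym: "complex_form X w k \<sigma> \<tau> = complex_form X w k \<tau> \<sigma>"
  by (simp add: complex_form_def eps_def Let_def Int_commute Un_commute min.commute max.commute mult.commute)

text \<open>Independence is a condition on pairs, and every pair other than \<open>a\<close>,
  \<open>b\<close> already lies in one of the two given faces. Hence the off-diagonal entries of the
  complex Laplacian sit where the exchanged vertices are adjacent.\<close>

lemma insert_insert_independent_iff:
  assumes "insert a \<rho> \<in> independence_complex V E" "insert b \<rho> \<in> independence_complex V E" "a \<noteq> b"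
  shows "insert a (insert b \<rho>) \<in> independence_complex V E \<longleftrightarrow> {a, b} \<notin> E"
proof -
  have "{b, a} = {a, b}" by auto
  thus ?thesis using assms unfolding independence_complex_def indep_def by auto
qed

text \<open>Each vertex belongs to \<open>\<sigma>\<close>, can be added to it, or has a neighbour
  in it. As weights are non-negative, overlaps can only increase the right-hand side; the excess is
  a diagonal entry of the non-negative correction.\<close>

lemma independent_weight_bound:
  fixes w :: "'a \<Rightarrow> real"
  assumes G: "finite_graph V E" and w: "\<And>v. v \<in> V \<Longrightarrow> w v \<ge> 0"
    and \<sigma>: "\<sigma> \<in> independence_complex V E"
  shows "(\<Sum>v\<in>V. w v) \<le> (\<Sum>u\<in>face_nbrs (independence_complex V E) \<sigma>. w u) + (\<Sum>v\<in>\<sigma>. w v)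
    + (\<Sum>a\<in>\<sigma>. \<Sum>u\<in>nbrs E a. w u)"
proof -
  have fin: "finite V" and \<sigma>V: "\<sigma> \<subseteq> V" using G \<sigma> by (auto simp: finite_graph_def independence_complex_def)
  have nb: "nbrs E a \<subseteq> V" for a
    using G by (fastforce simp: finite_graph_def nbrs_def nsets_def)
  let ?F = "face_nbrs (independence_complex V E) \<sigma>" and ?N = "\<Union>a\<in>\<sigma>. nbrs E a"
  have FV: "?F \<subseteq> V" by (auto simp: face_nbrs_def independence_complex_def)
  have "V \<subseteq> ?F \<union> \<sigma> \<union> ?N"
  proof
    fix v assume v: "v \<in> V"
    show "v \<in> ?F \<union> \<sigma> \<union> ?N"
    proof (cases "v \<in> \<sigma> \<union> ?N")
      case False
      hence "{v, a} \<notin> E" "{a, v} \<notin> E" if "a \<in> \<sigma>" for a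
        using that by (auto simp: nbrs_def insert_commute)
      hence "indep (insert v \<sigma>) E" using \<sigma> by (auto simp: indep_def independence_complex_def)
      thus ?thesis using v \<sigma>V False by (auto simp: face_nbrs_def independence_complex_def)
    qed auto
  qed
  hence V: "V = ?F \<union> \<sigma> \<union> ?N" using FV \<sigma>V nb by blast
  have le: "sum w (A \<union> B) \<le> sum w A + sum w B" if "A \<subseteq> V" "B \<subseteq> V" for A B
  proof -
    have "0 \<le> sum w (A \<inter> B)" using that w by (intro sum_nonneg) auto
    moreover have "sum w (A \<union> B) + sum w (A \<inter> B) = sum w A + sum w B"
      using that fin by (intro sum.union_inter) (auto intro: finite_subset)
    ultimately show ?thesis by linarith
  qed
  have NV: "?N \<subseteq> V" using nb by blast
  have "sum w (?F \<union> \<sigma> \<union> ?N) \<le> sum w (?F \<union> \<sigma>) + sum w ?N" using FV \<sigma>V NV by (intro le) auto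
  moreover have "sum w (?F \<union> \<sigma>) \<le> sum w ?F + sum w \<sigma>" using FV \<sigma>V by (intro le)
  moreover have "sum w ?N \<le> (\<Sum>a\<in>\<sigma>. \<Sum>u\<in>nbrs E a. w u)"
    using \<sigma>V nb fin w by (intro sum_UN_le) (auto intro: finite_subset)
  moreover have "sum w V = sum w (?F \<union> \<sigma> \<union> ?N)" using V by simp
  ultimately show ?thesis by linarith
qed

text \<open>The symmetrized complex Laplacian is \<open>(\<Sum>v\<in>V. w v) - M\<close> plus a non-negative diagonal matrix, where
  \<open>M\<close> is the principal submatrix on the faces of the additive compound of the symmetrized graph
  Laplacian.\<close>

lemma compound_form_ge:
  fixes V :: "'a::linorder set"
  assumes G: "finite_graph V E" and w: "\<And>v. v \<in> V \<Longrightarrow> w v \<ge> 0"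
    and f: "\<And>\<sigma>. \<sigma> \<notin> faces (independence_complex V E) k \<Longrightarrow> f \<sigma> = 0"
  defines "F \<equiv> faces (independence_complex V E) k"
  defines "K \<equiv> complex_form (independence_complex V E) w k"
  shows "(\<Sum>v\<in>V. w v) * (\<Sum>\<sigma>\<in>F. (f \<sigma>)\<^sup>2) - (\<Sum>\<sigma>\<in>F. \<Sum>\<tau>\<in>F. K \<sigma> \<tau> * (f \<sigma> * f \<tau>))
    \<le> (\<Sum>\<rho>\<in>nsets V k. \<Sum>a\<in>V. \<Sum>b\<in>V. graph_form E w a b *
      ((\<Prod>y\<in>\<rho>. osgn a y * osgn b y) * (f (insert a \<rho>) * f (insert b \<rho>))))"
proof -
  define X where "X = independence_complex V E"
  have finV: "finite V" using G by (simp add: finite_graph_def)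
  have X: "\<sigma> \<subseteq> V" if "\<sigma> \<in> X" for \<sigma> using that by (auto simp: X_def independence_complex_def)
  have Xin: "v \<in> V" if "\<sigma> \<in> X" "v \<in> \<sigma>" for \<sigma> v using X that by blast
  have Xfin: "finite \<sigma>" if "\<sigma> \<in> X" for \<sigma> using X[OF that] finV finite_subset by blast
  have finF: "finite F"
    by (rule finite_subset[of _ "Pow V"]) (use X finV in \<open>auto simp: F_def X_def faces_def\<close>)
  have F: "\<sigma> \<in> F \<longleftrightarrow> \<sigma> \<in> X \<and> card \<sigma> = Suc k" for \<sigma> by (auto simp: F_def X_def faces_def)
  have finS: "finite (nsets V k)" using finV by (rule finite_imp_finite_nsets)
  have f0: "f \<sigma> = 0" if "\<sigma> \<notin> F" for \<sigma> using f that F_def by blast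
  have f0': "\<sigma> \<in> F" if "f \<sigma> \<noteq> 0" for \<sigma> using f0 that by blast
  define d where "d = (\<lambda>a. \<Sum>u\<in>nbrs E a. w u)"
  define P where "P = (\<lambda>(a :: 'a) b \<rho>. \<Prod>y\<in>\<rho>. osgn a y * osgn b y :: real)"
  have Pself: "P a a \<rho> = (if a \<in> \<rho> then 0 else 1)" if "\<rho> \<in> nsets V k" for a \<rho>
    using that prod_osgn_self[of \<rho> a] by (auto simp: P_def nsets_def)
  define offS where "offS = (\<lambda>\<rho> a b. if a \<noteq> b \<and> {a, b} \<in> E
      then sqrt (w a * w b) * (P a b \<rho> * (f (insert a \<rho>) * f (insert b \<rho>))) else 0)"
  define offK where "offK = (\<lambda>\<sigma> \<tau>. if \<sigma> \<noteq> \<tau> then K \<sigma> \<tau> * (f \<sigma> * f \<tau>) else 0)"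

  \<comment> \<open>Diagonal terms: a pair \<open>\<rho>\<close>, \<open>a\<close> with
    \<open>a \<notin> \<rho>\<close> is the same as a face with a marked vertex, so each face
    collects the weighted degrees of its vertices.\<close>
  have "(\<Sum>\<rho>\<in>nsets V k. \<Sum>a\<in>V. d a * (P a a \<rho> * (f (insert a \<rho>))\<^sup>2))
      = (\<Sum>(\<rho>, a)\<in>nsets V k \<times> V. d a * (P a a \<rho> * (f (insert a \<rho>))\<^sup>2))"
    by (rule sum.cartesian_product)
  also have "\<dots> = (\<Sum>(\<rho>, a)\<in>{(\<rho>, a) \<in> nsets V k \<times> V. a \<notin> \<rho> \<and> insert a \<rho> \<in> F}. d a * (f (insert a \<rho>))\<^sup>2)"
    using finS finV by (intro sum.mono_neutral_cong_right)
      (auto simp: Pself split: if_splits intro: f0')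
  also have "\<dots> = (\<Sum>(\<sigma>, a)\<in>Sigma F (\<lambda>\<sigma>. \<sigma>). d a * (f \<sigma>)\<^sup>2)"
    by (rule sum.reindex_bij_witness[of _ "\<lambda>(\<sigma>, a). (\<sigma> - {a}, a)" "\<lambda>(\<rho>, a). (insert a \<rho>, a)"])
       (auto simp: F nsets_def insert_absorb intro: Xin Xfin)
  also have "\<dots> = (\<Sum>\<sigma>\<in>F. \<Sum>a\<in>\<sigma>. d a * (f \<sigma>)\<^sup>2)"
    using finF by (intro sum.Sigma[symmetric]) (auto simp: F intro: Xfin)
  finally have diagS: "(\<Sum>\<rho>\<in>nsets V k. \<Sum>a\<in>V. d a * (P a a \<rho> * (f (insert a \<rho>))\<^sup>2))
      = (\<Sum>\<sigma>\<in>F. (\<Sum>a\<in>\<sigma>. d a) * (f \<sigma>)\<^sup>2)" by (simp add: sum_distrib_right)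

  have un: "insert a (insert b \<rho>) \<in> X \<longleftrightarrow> {a, b} \<notin> E" if "insert a \<rho> \<in> F" "insert b \<rho> \<in> F" "a \<noteq> b" for a b \<rho>
    using insert_insert_independent_iff[of a \<rho> V E b] that by (simp add: F X_def)
  have out: "a \<notin> \<rho>" if "insert a \<rho> \<in> F" "\<rho> \<in> nsets V k" for a \<rho>
    using that unfolding F by (auto simp: nsets_def insert_absorb)
  \<comment> \<open>\<open>T\<close> carries the off-diagonal terms of the compound that can be
    non-zero, \<open>R\<close> those of \<open>K\<close>. Adding \<open>a\<close> or
    \<open>b\<close> to \<open>\<rho>\<close> maps \<open>T\<close> bijectively to \<open>R\<close>
    and preserves the terms.\<close>
  define T where "T = {(\<rho>, a, b) \<in> nsets V k \<times> V \<times> V. a \<noteq> b \<and> {a, b} \<in> E \<and> insert a \<rho> \<in> F \<and> insert b \<rho> \<in> F}"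
  define R where "R = {(\<sigma>, \<tau>) \<in> F \<times> F. \<sigma> \<noteq> \<tau> \<and> card (\<sigma> \<inter> \<tau>) = k \<and> \<sigma> \<union> \<tau> \<notin> X}"
  have T1: "offK (insert a \<rho>) (insert b \<rho>) = offS \<rho> a b" "(insert a \<rho>, insert b \<rho>) \<in> R"
    "insert a \<rho> \<inter> insert b \<rho> = \<rho>" "insert a \<rho> - insert b \<rho> = {a}" "insert b \<rho> - insert a \<rho> = {b}"
    if "(\<rho>, a, b) \<in> T" for \<rho> a b
  proof -
    have *: "\<rho> \<in> nsets V k" "a \<noteq> b" "{a, b} \<in> E" "insert a \<rho> \<in> F" "insert b \<rho> \<in> F"
      using that by (auto simp: T_def)
    have ab: "a \<notin> \<rho>" "b \<notin> \<rho>" using out * by auto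
    have nX: "insert a (insert b \<rho>) \<notin> X" using un[of a \<rho> b] * by blast
    have \<rho>: "finite \<rho>" "card \<rho> = k" using *(1) by (auto simp: nsets_def)
    have ne: "insert a \<rho> \<noteq> insert b \<rho>" using ab *(2) by auto
    show int: "insert a \<rho> \<inter> insert b \<rho> = \<rho>" using ab *(2) by auto
    show "insert a \<rho> - insert b \<rho> = {a}" "insert b \<rho> - insert a \<rho> = {b}" using ab *(2) by auto
    show "offK (insert a \<rho>) (insert b \<rho>) = offS \<rho> a b"
      using complex_form_insert[OF \<rho> ab *(2) nX, of w] * ne
      by (simp add: offK_def offS_def K_def X_def P_def)
    have "insert a \<rho> \<union> insert b \<rho> = insert a (insert b \<rho>)" by auto
    thus "(insert a \<rho>, insert b \<rho>) \<in> R" using * ne int \<rho> nX by (simp add: R_def)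
  qed
  have R1: "insert (the_elem (\<sigma> - \<tau>)) (\<sigma> \<inter> \<tau>) = \<sigma>" "insert (the_elem (\<tau> - \<sigma>)) (\<sigma> \<inter> \<tau>) = \<tau>"
    "(\<sigma> \<inter> \<tau>, the_elem (\<sigma> - \<tau>), the_elem (\<tau> - \<sigma>)) \<in> T" if "(\<sigma>, \<tau>) \<in> R" for \<sigma> \<tau>
  proof -
    have *: "\<sigma> \<in> F" "\<tau> \<in> F" "card (\<sigma> \<inter> \<tau>) = k" "\<sigma> \<union> \<tau> \<notin> X" using that by (auto simp: R_def)
    then obtain a b where ab: "\<sigma> - \<tau> = {a}" "\<tau> - \<sigma> = {b}" "\<sigma> = insert a (\<sigma> \<inter> \<tau>)" "\<tau> = insert b (\<sigma> \<inter> \<tau>)"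
      using card_inter_pairE[of \<sigma> k \<tau>] by (auto simp: F)
    have "\<sigma> \<subseteq> V" "\<tau> \<subseteq> V" using * X by (auto simp: F)
    hence V: "a \<in> V" "b \<in> V" "\<sigma> \<inter> \<tau> \<in> nsets V k"
      using ab(1,2) *(3) finite_subset[OF _ finV] by (auto simp: nsets_def)
    have "a \<noteq> b" using ab(1,2) by auto
    moreover have "\<sigma> \<union> \<tau> = insert a (insert b (\<sigma> \<inter> \<tau>))" using ab(3,4) by blast
    ultimately have "{a, b} \<in> E" using un[of a "\<sigma> \<inter> \<tau>" b] *(1,2,4) ab(3,4) by simp
    thus "(\<sigma> \<inter> \<tau>, the_elem (\<sigma> - \<tau>), the_elem (\<tau> - \<sigma>)) \<in> T"
      using V \<open>a \<noteq> b\<close> *(1,2) ab by (simp add: T_def)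
    show "insert (the_elem (\<sigma> - \<tau>)) (\<sigma> \<inter> \<tau>) = \<sigma>" "insert (the_elem (\<tau> - \<sigma>)) (\<sigma> \<inter> \<tau>) = \<tau>"
      using ab by simp_all
  qed
  have "(\<Sum>\<rho>\<in>nsets V k. \<Sum>a\<in>V. \<Sum>b\<in>V. offS \<rho> a b) = (\<Sum>(\<rho>, a, b)\<in>nsets V k \<times> V \<times> V. offS \<rho> a b)"
    by (simp add: sum.cartesian_product)
  also have "\<dots> = (\<Sum>(\<rho>, a, b)\<in>T. offS \<rho> a b)"
    using finS finV by (intro sum.mono_neutral_right) (auto simp: T_def offS_def intro: f0' split: if_splits)
  also have "\<dots> = (\<Sum>(\<sigma>, \<tau>)\<in>R. offK \<sigma> \<tau>)"
    by (rule sum.reindex_bij_witness[of _ "\<lambda>(\<sigma>, \<tau>). (\<sigma> \<inter> \<tau>, the_elem (\<sigma> - \<tau>), the_elem (\<tau> - \<sigma>))"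
          "\<lambda>(\<rho>, a, b). (insert a \<rho>, insert b \<rho>)"])
       (simp_all only: split_paired_all prod.case T1 R1 the_elem_eq)
  also have "\<dots> = (\<Sum>(\<sigma>, \<tau>)\<in>F \<times> F. offK \<sigma> \<tau>)"
    using finF by (intro sum.mono_neutral_left) (auto simp: R_def offK_def K_def complex_form_def X_def split: if_splits)
  also have "\<dots> = (\<Sum>\<sigma>\<in>F. \<Sum>\<tau>\<in>F. offK \<sigma> \<tau>)" by (simp add: sum.cartesian_product)
  finally have off: "(\<Sum>\<rho>\<in>nsets V k. \<Sum>a\<in>V. \<Sum>b\<in>V. offS \<rho> a b) = (\<Sum>\<sigma>\<in>F. \<Sum>\<tau>\<in>F. offK \<sigma> \<tau>)" .

  \<comment> \<open>Off-diagonal entries of the graph form are negative, hence the minus sign in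
    front of \<open>offS\<close>.\<close>
  have "graph_form E w a b * (P a b \<rho> * (f (insert a \<rho>) * f (insert b \<rho>)))
      = (if a = b then d a * (P a a \<rho> * (f (insert a \<rho>))\<^sup>2) else 0) - offS \<rho> a b" for a b \<rho>
    by (auto simp: graph_form_def d_def offS_def power2_eq_square)
  hence S: "(\<Sum>\<rho>\<in>nsets V k. \<Sum>a\<in>V. \<Sum>b\<in>V. graph_form E w a b * (P a b \<rho> * (f (insert a \<rho>) * f (insert b \<rho>))))
      = (\<Sum>\<sigma>\<in>F. (\<Sum>a\<in>\<sigma>. d a) * (f \<sigma>)\<^sup>2) - (\<Sum>\<sigma>\<in>F. \<Sum>\<tau>\<in>F. offK \<sigma> \<tau>)"
    unfolding diagS[symmetric] off[symmetric] using finV by (simp add: sum_subtractf sum.delta)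
  have "K \<sigma> \<tau> * (f \<sigma> * f \<tau>) = (if \<sigma> = \<tau> then K \<sigma> \<sigma> * (f \<sigma>)\<^sup>2 else 0) + offK \<sigma> \<tau>" for \<sigma> \<tau>
    by (auto simp: offK_def power2_eq_square)
  hence K: "(\<Sum>\<sigma>\<in>F. \<Sum>\<tau>\<in>F. K \<sigma> \<tau> * (f \<sigma> * f \<tau>)) = (\<Sum>\<sigma>\<in>F. K \<sigma> \<sigma> * (f \<sigma>)\<^sup>2) + (\<Sum>\<sigma>\<in>F. \<Sum>\<tau>\<in>F. offK \<sigma> \<tau>)"
    using finF by (simp add: sum.distrib sum.delta)
  \<comment> \<open>The off-diagonal parts cancel, so only the diagonals need comparing, face by
    face.\<close>
  have "(\<Sum>v\<in>V. w v) * (\<Sum>\<sigma>\<in>F. (f \<sigma>)\<^sup>2) \<le> (\<Sum>\<sigma>\<in>F. K \<sigma> \<sigma> * (f \<sigma>)\<^sup>2 + (\<Sum>a\<in>\<sigma>. d a) * (f \<sigma>)\<^sup>2)"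
    unfolding sum_distrib_left
  proof (rule sum_mono)
    fix \<sigma> assume "\<sigma> \<in> F"
    hence "(\<Sum>v\<in>V. w v) \<le> K \<sigma> \<sigma> + (\<Sum>a\<in>\<sigma>. d a)"
      using independent_weight_bound[OF G w] by (simp add: F X_def K_def complex_form_def d_def)
    from mult_right_mono[OF this, of "(f \<sigma>)\<^sup>2"]
    show "(\<Sum>v\<in>V. w v) * (f \<sigma>)\<^sup>2 \<le> K \<sigma> \<sigma> * (f \<sigma>)\<^sup>2 + (\<Sum>a\<in>\<sigma>. d a) * (f \<sigma>)\<^sup>2"
      by (simp add: distrib_right)
  qed
  thus ?thesis using S K unfolding P_def sum.distrib by linarith
qed

section \<open>Dimension count and interlacing\<close>

text \<open>Pad the \<open>m\<close> equations with zero rows to a square matrix. Row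
  \<open>m\<close> is zero, so every product in the Leibniz formula vanishes and the matrix has a
  non-trivial kernel.\<close>

lemma underdetermined_system:
  fixes c :: "nat \<Rightarrow> nat \<Rightarrow> real"
  assumes "m < i"
  obtains z where "\<exists>p<i. z p \<noteq> 0" "\<And>q. q < m \<Longrightarrow> (\<Sum>p<i. z p * c q p) = 0"
proof -
  define A where "A = mat i i (\<lambda>(q, p). if q < m then c q p else 0)"
  have A: "A \<in> carrier_mat i i" by (simp add: A_def)
  have "det A = 0"
  proof -
    have "(\<Prod>q = 0..<i. A $$ (q, \<pi> q)) = 0" if "\<pi> permutes {0..<i}" for \<pi>
      using assms permutes_in_image[OF that, of m] by (intro prod_zero bexI[of _ m]) (auto simp: A_def)
    thus ?thesis unfolding det_def'[OF A] by (intro sum.neutral) (simp del: prod_zero_iff)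
  qed
  then obtain v where v: "v \<in> carrier_vec i" "v \<noteq> 0\<^sub>v i" "A *\<^sub>v v = 0\<^sub>v i"
    using det_0_iff_vec_prod_zero[OF A] by blast
  show ?thesis
  proof
    show "\<exists>p<i. v $ p \<noteq> 0"
    proof (rule ccontr)
      assume "\<not> (\<exists>p<i. v $ p \<noteq> 0)"
      hence "v = 0\<^sub>v i" using v(1) by (intro eq_vecI) auto
      thus False using v(2) by simp
    qed
    fix q assume q: "q < m"
    have "(A *\<^sub>v v) $ q = (\<Sum>p<i. v $ p * c q p)"
      using q assms v(1) by (simp add: A_def scalar_prod_def lessThan_atLeast0 mult.commute)
    thus "(\<Sum>p<i. v $ p * c q p) = 0" using v(3) q assms by simp
  qed
qed

text \<open>In decreasing order, an entry strictly above the one at position \<open>i - 1\<close>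
  must stand before it. Indices \<open>J\<close> are counted rather than values, so multiplicities
  are respected.\<close>

lemma card_above_ith_largest:
  assumes "finite N" "1 \<le> i"
  shows "card {J \<in> N. ith_largest (image_mset g (mset_set N)) i < g J} < i"
proof -
  define M where "M = image_mset g (mset_set N)"
  define L where "L = rev (sorted_list_of_multiset M)"
  define s where "s = ith_largest M i"
  have s: "s = L ! (i - 1)" by (simp add: s_def ith_largest_def L_def)
  have L: "sorted_wrt (\<ge>) L" unfolding L_def sorted_wrt_rev by simp
  have "card {J \<in> N. s < g J} = size (filter_mset (\<lambda>x. s < x) M)"
    using assms(1) by (simp add: M_def filter_mset_image_mset filter_mset_mset_set)
  also have "\<dots> = size (filter_mset (\<lambda>x. s < x) (mset L))" by (simp add: L_def)
  also have "\<dots> = length (filter (\<lambda>x. s < x) L)" by (metis mset_filter size_mset)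
  also have "\<dots> = card {p. p < length L \<and> s < L ! p}" by (rule length_filter_conv_card)
  also have "\<dots> \<le> card {..<i - 1}"
  proof (rule card_mono)
    show "{p. p < length L \<and> s < L ! p} \<subseteq> {..<i - 1}"
    proof
      fix p assume p: "p \<in> {p. p < length L \<and> s < L ! p}"
      have "L ! p \<le> s" if "i - 1 < p" using sorted_wrt_nth_less[OF L that] p s by simp
      hence "\<not> i - 1 < p" using p by force
      moreover have "p \<noteq> i - 1" using p s by auto
      ultimately show "p \<in> {..<i - 1}" by simp
    qed
  qed simp
  also have "\<dots> < i" using assms(2) by simp
  finally show ?thesis unfolding s_def M_def .
qed

theorem theorem1p3:
  fixes V :: "'a::linorder set" and E :: "'a set set" and w :: "'a \<Rightarrow> real" and k i :: nat
  assumes "finite_graph V E"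
    and "\<And>v. v \<in> V \<Longrightarrow> w v \<ge> 0"
    and "1 \<le> i" and "i \<le> card (faces (independence_complex V E) k)"
  shows "ith_smallest (eigs (complex_laplacian (independence_complex V E) w k)) i
           \<ge> (\<Sum>v\<in>V. w v) - ith_largest (eig_sums (k + 1) (graph_laplacian V E w)) i"
proof -
  define X where "X = independence_complex V E"
  define F where "F = faces X k"
  define n where "n = card V"
  define m where "m = card F"
  have finV: "finite V" using assms(1) by (simp add: finite_graph_def)
  have XV: "\<sigma> \<subseteq> V" if "\<sigma> \<in> X" for \<sigma> using that by (auto simp: X_def independence_complex_def)
  have finF: "finite F"
    by (rule finite_subset[of _ "Pow V"]) (use XV finV in \<open>auto simp: F_def faces_def\<close>)
  have im: "i \<le> m" using assms(4) by (simp add: m_def F_def X_def)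

  define \<mu> where "\<mu> = sorted_list_of_multiset (eigs (graph_laplacian V E w))"
  obtain xs where xs: "distinct xs" "set xs = V" "\<And>A. mat_on V A = mat_of_list xs A"
    using mat_on_some_list[OF finV] by metis
  have \<mu>: "\<mu> = sorted_list_of_multiset (eigs (mat_of_list xs (graph_form E w)))"
    using eigs_graph_laplacian[OF finV, of w E] assms(2) by (simp only: \<mu>_def xs(3))
  have symS: "graph_form E w a b = graph_form E w b a" for a b
    by (simp add: graph_form_def insert_commute mult.commute)
  obtain v where "length \<mu> = n"
    and "\<And>j l. j < n \<Longrightarrow> l < n \<Longrightarrow> (\<Sum>a\<in>V. v j a * v l a) = (if j = l then 1 else 0)"
    and v: "\<And>a b. a \<in> V \<Longrightarrow> b \<in> V \<Longrightarrow> (\<Sum>j<n. v j a * v j b) = (if a = b then 1 else 0)"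
    and S: "\<And>a b. a \<in> V \<Longrightarrow> b \<in> V \<Longrightarrow> graph_form E w a b = (\<Sum>j<n. \<mu> ! j * (v j a * v j b))"
    by (rule mat_of_list_spectral[where A = "graph_form E w", OF xs(1,2) symS, folded \<mu> n_def]) (rule that; assumption)
  interpret V: orthonormal_frame V n v by unfold_locales (fact finV, rule v)

  define \<kappa> where "\<kappa> = sorted_list_of_multiset (eigs (complex_laplacian X w k))"
  obtain ys where ys: "distinct ys" "set ys = F" "\<And>A. mat_on F A = mat_of_list ys A"
    using mat_on_some_list[OF finF] by metis
  have \<kappa>: "\<kappa> = sorted_list_of_multiset (eigs (mat_of_list ys (complex_form X w k)))"
    using eigs_complex_laplacian[OF finV, of X w k] XV assms(2) ys(3)
    by (simp only: \<kappa>_def F_def)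
  obtain y where len: "length \<kappa> = m"
    and y: "\<And>p q. p < m \<Longrightarrow> q < m \<Longrightarrow> (\<Sum>\<sigma>\<in>F. y p \<sigma> * y q \<sigma>) = (if p = q then 1 else 0)"
    and y': "\<And>\<sigma> \<tau>. \<sigma> \<in> F \<Longrightarrow> \<tau> \<in> F \<Longrightarrow> (\<Sum>p<m. y p \<sigma> * y p \<tau>) = (if \<sigma> = \<tau> then 1 else 0)"
    and K: "\<And>\<sigma> \<tau>. \<sigma> \<in> F \<Longrightarrow> \<tau> \<in> F \<Longrightarrow>
      complex_form X w k \<sigma> \<tau> = (\<Sum>p<m. \<kappa> ! p * (y p \<sigma> * y p \<tau>))"
    by (rule mat_of_list_spectral[where A = "complex_form X w k", OF ys(1,2) complex_form_sym, folded \<kappa> m_def]) (rule that; assumption)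
  interpret F: orthonormal_frame F m y by unfold_locales (fact finF, rule y')

  define s where "s = ith_largest (eig_sums (k + 1) (graph_laplacian V E w)) i"
  define N where "N = nsets {..<n} (Suc k)"
  \<comment> \<open>The index sets whose eigenvalue sum is strictly above the bound
    \<open>s\<close>; ties are left out, which keeps their number below \<open>i\<close>.\<close>
  define T where "T = {J \<in> N. s < (\<Sum>j\<in>J. \<mu> ! j)}"
  have finN: "finite N" by (simp add: N_def finite_imp_finite_nsets)
  have "length xs = n" using xs distinct_card n_def by metis
  hence "dim_row (graph_laplacian V E w) = n" by (simp add: graph_laplacian_def xs(3) mat_of_list_def)
  hence "eig_sums (k + 1) (graph_laplacian V E w) = image_mset (\<lambda>J. \<Sum>j\<in>J. \<mu> ! j) (mset_set N)"
    by (simp add: eig_sums_def \<mu>_def N_def)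
  hence cardT: "card T < i"
    unfolding T_def s_def using card_above_ith_largest[OF finN assms(3)] by simp
  obtain h where h: "bij_betw h {..<card T} T"
    using ex_bij_betw_nat_finite[of T] finN by (auto simp: T_def lessThan_atLeast0)

  \<comment> \<open>The \<open>p\<close>-th eigenvector on the faces, extended by 0 to all sets and
    made alternating.\<close>
  define g where "g = (\<lambda>p t. lsign t * (if set t \<in> F then y p (set t) else 0))"
  obtain z where z0: "\<exists>p<i. z p \<noteq> 0"
    \<comment> \<open>One linear condition for each element of \<open>T\<close>, in \<open>i\<close>
      unknowns.\<close>
    and z: "\<And>q. q < card T \<Longrightarrow> (\<Sum>p<i. z p * V.coef (g p) (sorted_list_of_set (h q))) = 0"
    using underdetermined_system[OF cardT, of "\<lambda>q p. V.coef (g p) (sorted_list_of_set (h q))"] by metis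
  define f where "f = (\<lambda>\<sigma>. if \<sigma> \<in> F then \<Sum>p<i. z p * y p \<sigma> else 0)"
  have fg: "(\<lambda>t. lsign t * f (set t)) = (\<lambda>t. \<Sum>p<i. z p * g p t)"
    by (rule ext) (simp add: f_def g_def sum_distrib_left mult.left_commute)
  have T0: "V.coef (\<lambda>t. lsign t * f (set t)) (sorted_list_of_set J) = 0" if "J \<in> T" for J
  proof -
    have "J \<in> h ` {..<card T}" using that h by (simp add: bij_betw_def)
    then obtain q where "q < card T" "J = h q" by blast
    thus ?thesis unfolding fg V.coef_sum using z by simp
  qed

  \<comment> \<open>By orthonormality, the coordinates of \<open>f\<close> in the eigenbasis on the
    faces are \<open>z\<close> followed by zeros.\<close>
  have yf: "(\<Sum>\<sigma>\<in>F. y q \<sigma> * f \<sigma>) = (if q < i then z q else 0)" if "q < m" for q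
  proof -
    have "(\<Sum>\<sigma>\<in>F. y q \<sigma> * f \<sigma>) = (\<Sum>\<sigma>\<in>F. \<Sum>p<i. z p * (y q \<sigma> * y p \<sigma>))"
      by (intro sum.cong refl) (simp add: f_def sum_distrib_left mult.left_commute)
    also have "\<dots> = (\<Sum>p<i. z p * (\<Sum>\<sigma>\<in>F. y q \<sigma> * y p \<sigma>))"
      by (subst sum.swap) (simp add: sum_distrib_left)
    also have "\<dots> = (\<Sum>p<i. if q = p then z p else 0)"
      using that im by (intro sum.cong refl) (simp add: y)
    finally show ?thesis by (simp add: sum.delta)
  qed
  have restrict: "(\<Sum>q<m. if q < i then G q else 0) = (\<Sum>q<i. G q)" for G :: "nat \<Rightarrow> real"
    using im by (intro sum.mono_neutral_cong_right) auto
  define Z where "Z = (\<Sum>\<sigma>\<in>F. (f \<sigma>)\<^sup>2)"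
  have "Z = (\<Sum>q<m. (\<Sum>\<sigma>\<in>F. y q \<sigma> * f \<sigma>)\<^sup>2)"
    unfolding Z_def power2_eq_square by (rule F.parseval[symmetric])
  also have "\<dots> = (\<Sum>q<m. if q < i then (z q)\<^sup>2 else 0)" by (intro sum.cong refl) (simp add: yf)
  finally have Z: "Z = (\<Sum>q<i. (z q)\<^sup>2)" unfolding restrict .
  have Zpos: "Z > 0" using z0 unfolding Z by (auto intro!: sum_pos2)

  \<comment> \<open>Upper bound on the Rayleigh quotient: \<open>f\<close> involves only the first
    \<open>i\<close> eigenvectors, and positions start at 0, so the largest eigenvalue concerned is
    \<open>\<kappa> ! (i - 1)\<close>.\<close>
  have "(\<Sum>\<sigma>\<in>F. \<Sum>\<tau>\<in>F. complex_form X w k \<sigma> \<tau> * (f \<sigma> * f \<tau>)) = (\<Sum>q<m. \<kappa> ! q * (\<Sum>\<sigma>\<in>F. y q \<sigma> * f \<sigma>)\<^sup>2)"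
    by (rule F.quadratic_form_frame[symmetric]) (rule K)
  also have "\<dots> = (\<Sum>q<m. if q < i then \<kappa> ! q * (z q)\<^sup>2 else 0)" by (intro sum.cong refl) (simp add: yf)
  also have "\<dots> = (\<Sum>q<i. \<kappa> ! q * (z q)\<^sup>2)" by (rule restrict)
  also have "\<dots> \<le> (\<Sum>q<i. \<kappa> ! (i - 1) * (z q)\<^sup>2)"
  proof (rule sum_mono)
    fix q assume "q \<in> {..<i}"
    hence "q \<le> i - 1" "i - 1 < length \<kappa>" using im len by auto
    hence "\<kappa> ! q \<le> \<kappa> ! (i - 1)" unfolding \<kappa>_def by (intro sorted_nth_mono) auto
    thus "\<kappa> ! q * (z q)\<^sup>2 \<le> \<kappa> ! (i - 1) * (z q)\<^sup>2" by (intro mult_right_mono) auto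
  qed
  finally have upper: "(\<Sum>\<sigma>\<in>F. \<Sum>\<tau>\<in>F. complex_form X w k \<sigma> \<tau> * (f \<sigma> * f \<tau>)) \<le> \<kappa> ! (i - 1) * Z"
    unfolding Z sum_distrib_left .

  \<comment> \<open>Lower bound for the same form: compare with the compound, whose form at
    \<open>f\<close> is at most \<open>s * Z\<close> because the coefficients indexed by
    \<open>T\<close> vanish.\<close>
  have "(\<Sum>v\<in>V. w v) * Z - (\<Sum>\<sigma>\<in>F. \<Sum>\<tau>\<in>F. complex_form X w k \<sigma> \<tau> * (f \<sigma> * f \<tau>))
    \<le> (\<Sum>\<rho>\<in>nsets V k. \<Sum>a\<in>V. \<Sum>b\<in>V. graph_form E w a b *
      ((\<Prod>y\<in>\<rho>. osgn a y * osgn b y) * (f (insert a \<rho>) * f (insert b \<rho>))))"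
    unfolding Z_def F_def X_def
    by (rule compound_form_ge[OF assms(1)]) (auto simp: assms(2) f_def F_def X_def)
  also have "\<dots> \<le> s * (\<Sum>\<sigma>\<in>nsets V (Suc k). (f \<sigma>)\<^sup>2)"
  proof (rule compound_form_le[OF V.orthonormal_frame_axioms S T0])
    fix J assume "J \<in> nsets {..<n} (Suc k)" "J \<notin> T"
    thus "(\<Sum>j\<in>J. \<mu> ! j) \<le> s" by (auto simp: T_def N_def not_less)
  qed
  also have "(\<Sum>\<sigma>\<in>nsets V (Suc k). (f \<sigma>)\<^sup>2) = Z"
    unfolding Z_def using finV XV
    by (intro sum.mono_neutral_right)
       (auto simp: F_def faces_def nsets_def f_def finite_imp_finite_nsets intro: finite_subset)
  finally have "((\<Sum>v\<in>V. w v) - s) * Z \<le> \<kappa> ! (i - 1) * Z"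
    using upper by (simp add: left_diff_distrib)
  hence "(\<Sum>v\<in>V. w v) - s \<le> \<kappa> ! (i - 1)" using Zpos by simp
  thus ?thesis by (simp add: ith_smallest_def \<kappa>_def X_def s_def)
qed

end
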